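(* Let $(E,\mathcal F,\mu)$ be a probability space and let $P$ be a Markov operator on $L^2(\mu)$ with $\mu P=\mu$ which is ergodic (i.e. $1$ is a simple eigenvalue of $P$). Let $P^*$ be the adjoint of $P$ on $L^2(\mu)$ and $\hat P=\frac12(P+P^* )$. Then the following statements are equivalent: (1) There is a constant $\theta\in[-1,1)$ such that the Poincar\'e inequality $$\mu(f^2)\le \frac{1}{1-\theta}\,\mu\big(f(f-Pf)\big)+\mu(f)^2,\qquad f\in L^2(\mu),$$ holds, i.e. $\hat P$ has a spectral gap ($1$ is an isolated point of the spectrum of $\hat P$). (2) $\|P\|_\tau<1$. (3) $\inf_{m\in\mathbb N}\|P^{2m-1}\|_\tau<1$. (4) $\inf_{m\in\mathbb N}\|\hat P^{m}\|_{tail}<1$.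
   Context: A Markov operator on $L^2(\mu)$ is a linear operator $P$ on $L^2(\mu)$ with $P1=1$ and $Pf\ge0$ whenever $f\ge0$; $\mu P=\mu$ means $\mu(Pf)=\mu(f)$ for all $f$. For a bounded operator $Q$ on $L^2(\mu)$ the tail norms are $$\|Q\|_\tau:=\lim_{R\to\infty}\sup_{\mu(f^2)\le1}\mu\big(f(Qf-R)^+\big),\qquad \|Q\|_{tail}:=\lim_{R\to\infty}\sup_{\mu(f^2)\le1}\mu\Big(\big((|Qf|-R)^+\big)^2\Big)^{1/2}.$$ *)

theory Defs
  imports "HOL-Probability.Probability"
begin

text \<open>Square-integrable real functions on a measure space (representatives of L^2(mu)).\<close>
definition L2 :: "'a measure \<Rightarrow> ('a \<Rightarrow> real) set" where
  "L2 M = {f. f \<in> borel_measurable M \<and> integrable M (\<lambda>x. (f x)\<^sup>2)}"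

definition markov_operator :: "'a measure \<Rightarrow> (('a \<Rightarrow> real) \<Rightarrow> ('a \<Rightarrow> real)) \<Rightarrow> bool" where
  "markov_operator M P \<longleftrightarrow>
     (\<forall>f\<in>L2 M. P f \<in> L2 M) \<and>
     (\<forall>f\<in>L2 M. \<forall>g\<in>L2 M. (AE x in M. f x = g x) \<longrightarrow> (AE x in M. P f x = P g x)) \<and>
     (\<forall>f\<in>L2 M. \<forall>g\<in>L2 M. \<forall>a b::real.
        AE x in M. P (\<lambda>y. a * f y + b * g y) x = a * P f x + b * P g x) \<and>
     (AE x in M. P (\<lambda>_. 1) x = 1) \<and>
     (\<forall>f\<in>L2 M. (AE x in M. f x \<ge> 0) \<longrightarrow> (AE x in M. P f x \<ge> 0))"

definition invariant_measure :: "'a measure \<Rightarrow> (('a \<Rightarrow> real) \<Rightarrow> ('a \<Rightarrow> real)) \<Rightarrow> bool" where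
  "invariant_measure M P \<longleftrightarrow> (\<forall>f\<in>L2 M. integral\<^sup>L M (P f) = integral\<^sup>L M f)"

definition ergodic_op :: "'a measure \<Rightarrow> (('a \<Rightarrow> real) \<Rightarrow> ('a \<Rightarrow> real)) \<Rightarrow> bool" where
  "ergodic_op M P \<longleftrightarrow>
     (\<forall>f\<in>L2 M. (AE x in M. P f x = f x) \<longrightarrow> (\<exists>c::real. AE x in M. f x = c))"

definition is_adjoint :: "'a measure \<Rightarrow> (('a \<Rightarrow> real) \<Rightarrow> ('a \<Rightarrow> real)) \<Rightarrow>
    (('a \<Rightarrow> real) \<Rightarrow> ('a \<Rightarrow> real)) \<Rightarrow> bool" where
  "is_adjoint M Q Q' \<longleftrightarrow> (\<forall>g\<in>L2 M. Q' g \<in> L2 M) \<and>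
     (\<forall>f\<in>L2 M. \<forall>g\<in>L2 M.
        integral\<^sup>L M (\<lambda>x. g x * Q f x) = integral\<^sup>L M (\<lambda>x. Q' g x * f x))"

definition pos_part :: "real \<Rightarrow> real" where
  "pos_part t = max t 0"

definition tau_norm :: "'a measure \<Rightarrow> (('a \<Rightarrow> real) \<Rightarrow> ('a \<Rightarrow> real)) \<Rightarrow> real" where
  "tau_norm M Q = Lim at_top (\<lambda>R::real.
     Sup {integral\<^sup>L M (\<lambda>x. f x * pos_part (Q f x - R)) | f.
            f \<in> L2 M \<and> integral\<^sup>L M (\<lambda>x. (f x)\<^sup>2) \<le> 1})"

definition tail_norm :: "'a measure \<Rightarrow> (('a \<Rightarrow> real) \<Rightarrow> ('a \<Rightarrow> real)) \<Rightarrow> real" where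
  "tail_norm M Q = Lim at_top (\<lambda>R::real.
     Sup {sqrt (integral\<^sup>L M (\<lambda>x. (pos_part (\<bar>Q f x\<bar> - R))\<^sup>2)) | f.
            f \<in> L2 M \<and> integral\<^sup>L M (\<lambda>x. (f x)\<^sup>2) \<le> 1})"

end

theory Submission
  imports Defs
begin

text \<open>Write \<open>\<E>(f) = \<mu>(f (f - P f))\<close>. If the Poincare inequality fails, there are \<open>f\<close> with
  \<open>\<mu>(f) = 0\<close>, \<open>\<mu>(f\<^sup>2) = 1\<close> and \<open>\<E>(f)\<close> arbitrarily small. From these one builds nonnegative
  unit vectors with small \<open>\<E>\<close> and small mean, which force all tail norms of all powers to be at
  least one. If the squares \<open>f\<^sup>2\<close> are not uniformly integrable, one takes \<open>(|f| - K)\<^sup>+\<close>.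
  Otherwise truncation yields \<open>[0, 1]\<close>-valued functions with variance bounded below; almost
  invariant bounded functions form an algebra by Jensen's inequality, and by ergodicity they are
  asymptotically independent of any fixed function, so products \<open>G\<close> of many of them have
  \<open>\<mu>(G)\<^sup>2 / \<mu>(G\<^sup>2)\<close> arbitrarily small.

  Conversely, cutting off \<open>P f\<close> at a high level leaves essentially only the contribution of the
  excess \<open>(f - S)\<^sup>+\<close>, whose mean is at most \<open>1 / S\<close>; the Poincare inequality bounds
  \<open>\<mu>(g P g)\<close> strictly below \<open>\<mu>(g\<^sup>2)\<close> for functions \<open>g\<close> of small mean.\<close>

section \<open>Square-integrable functions\<close>

lemma pos_part_nonneg [simp]: "0 \<le> pos_part t"
  by (simp add: pos_part_def)

lemma pos_part_ge [simp]: "t \<le> pos_part t"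
  by (simp add: pos_part_def)

lemma pos_part_diff_le_abs: "0 \<le> R \<Longrightarrow> pos_part (t - R) \<le> \<bar>t\<bar>"
  by (simp add: pos_part_def)

lemma pos_part_mono: "s \<le> t \<Longrightarrow> pos_part s \<le> pos_part t"
  by (simp add: pos_part_def)

lemma pos_part_cmult: "0 \<le> a \<Longrightarrow> pos_part (a * t) = a * pos_part t"
  by (simp add: pos_part_def max_mult_distrib_left)

lemma borel_measurable_pos_part [measurable]: "pos_part \<in> borel_measurable borel"
  unfolding pos_part_def by measurable

lemma L2_measurable [measurable_dest]: "f \<in> L2 M \<Longrightarrow> f \<in> borel_measurable M"
  by (simp add: L2_def)

lemma L2_integrable_square: "f \<in> L2 M \<Longrightarrow> integrable M (\<lambda>x. (f x)\<^sup>2)"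
  by (simp add: L2_def)

lemma L2_dominated:
  assumes f: "f \<in> L2 M" and [measurable]: "g \<in> borel_measurable M"
    and "AE x in M. \<bar>g x\<bar> \<le> \<bar>f x\<bar>"
  shows "g \<in> L2 M"
proof -
  have "integrable M (\<lambda>x. (g x)\<^sup>2)"
    by (rule Bochner_Integration.integrable_bound[OF L2_integrable_square[OF f]])
      (use assms(3) in \<open>auto simp: abs_le_square_iff\<close>)
  then show ?thesis by (simp add: L2_def)
qed

lemma L2_abs [simp]: "f \<in> L2 M \<Longrightarrow> (\<lambda>x. \<bar>f x\<bar>) \<in> L2 M"
  by (rule L2_dominated) (auto dest: L2_measurable)

lemma L2_pos_part [simp]: "f \<in> L2 M \<Longrightarrow> (\<lambda>x. pos_part (f x)) \<in> L2 M"
  by (rule L2_dominated) (auto dest: L2_measurable simp: pos_part_def)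

lemma L2_mult_integrable:
  assumes "f \<in> L2 M" "g \<in> L2 M"
  shows "integrable M (\<lambda>x. f x * g x)"
proof (rule Bochner_Integration.integrable_bound)
  show "integrable M (\<lambda>x. (f x)\<^sup>2 + (g x)\<^sup>2)"
    using assms by (simp add: L2_integrable_square)
  show "(\<lambda>x. f x * g x) \<in> borel_measurable M"
    using assms[THEN L2_measurable] by measurable
  have "\<bar>a * b\<bar> \<le> a\<^sup>2 + b\<^sup>2" for a b :: real
    using sum_squares_bound[of "\<bar>a\<bar>" "\<bar>b\<bar>"] abs_ge_zero[of "a * b"]
    unfolding abs_mult power2_abs by linarith
  then show "AE x in M. norm (f x * g x) \<le> norm ((f x)\<^sup>2 + (g x)\<^sup>2)" by simp
qed

lemma L2_cmult [simp]: "f \<in> L2 M \<Longrightarrow> (\<lambda>x. a * f x) \<in> L2 M"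
  by (auto simp: L2_def power_mult_distrib)

lemma L2_add [simp]:
  assumes "f \<in> L2 M" "g \<in> L2 M"
  shows "(\<lambda>x. f x + g x) \<in> L2 M"
  using assms L2_mult_integrable[OF assms]
  by (auto simp: L2_def power2_sum mult.assoc
      intro!: borel_measurable_add Bochner_Integration.integrable_add)

lemma L2_diff [simp]:
  assumes "f \<in> L2 M" "g \<in> L2 M"
  shows "(\<lambda>x. f x - g x) \<in> L2 M"
  using L2_add[OF assms(1) L2_cmult[OF assms(2), of "-1"]] by simp

lemma L2_uminus [simp]: "f \<in> L2 M \<Longrightarrow> (\<lambda>x. - f x) \<in> L2 M"
  using L2_cmult[of f M "-1"] by simp

lemma L2_divide [simp]: "f \<in> L2 M \<Longrightarrow> (\<lambda>x. f x / a) \<in> L2 M"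
  using L2_cmult[of f M "inverse a"] by (simp add: divide_inverse_commute)

definition L2_inner :: "'a measure \<Rightarrow> ('a \<Rightarrow> real) \<Rightarrow> ('a \<Rightarrow> real) \<Rightarrow> real" where
  "L2_inner M f g = integral\<^sup>L M (\<lambda>x. f x * g x)"

definition L2_norm :: "'a measure \<Rightarrow> ('a \<Rightarrow> real) \<Rightarrow> real" where
  "L2_norm M f = sqrt (L2_inner M f f)"

lemma L2_inner_commute: "L2_inner M f g = L2_inner M g f"
  by (simp add: L2_inner_def mult.commute)

lemma L2_inner_self: "L2_inner M f f = integral\<^sup>L M (\<lambda>x. (f x)\<^sup>2)"
  by (simp add: L2_inner_def power2_eq_square)

lemma L2_norm_power2: "(L2_norm M f)\<^sup>2 = L2_inner M f f"
  by (simp add: L2_norm_def L2_inner_def)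

lemma L2_norm_nonneg [simp]: "0 \<le> L2_norm M f"
  by (simp add: L2_norm_def L2_inner_def)

lemma L2_inner_add_left:
  assumes "f \<in> L2 M" "g \<in> L2 M" "h \<in> L2 M"
  shows "L2_inner M (\<lambda>x. f x + g x) h = L2_inner M f h + L2_inner M g h"
  using assms by (simp add: L2_inner_def distrib_right L2_mult_integrable)

lemma L2_inner_diff_left:
  assumes "f \<in> L2 M" "g \<in> L2 M" "h \<in> L2 M"
  shows "L2_inner M (\<lambda>x. f x - g x) h = L2_inner M f h - L2_inner M g h"
  using assms by (simp add: L2_inner_def left_diff_distrib L2_mult_integrable)

lemma L2_inner_cmult_left: "L2_inner M (\<lambda>x. a * f x) g = a * L2_inner M f g"
  by (simp add: L2_inner_def mult.assoc)

lemma L2_inner_minus_left: "L2_inner M (\<lambda>x. - f x) g = - L2_inner M f g"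
  by (simp add: L2_inner_def)

lemma L2_inner_divide_left: "L2_inner M (\<lambda>x. f x / a) g = L2_inner M f g / a"
  by (simp add: L2_inner_def)

lemma L2_inner_add_right:
  assumes "f \<in> L2 M" "g \<in> L2 M" "h \<in> L2 M"
  shows "L2_inner M f (\<lambda>x. g x + h x) = L2_inner M f g + L2_inner M f h"
  using assms by (simp add: L2_inner_commute[of M f] L2_inner_add_left)

lemma L2_inner_diff_right:
  assumes "f \<in> L2 M" "g \<in> L2 M" "h \<in> L2 M"
  shows "L2_inner M f (\<lambda>x. g x - h x) = L2_inner M f g - L2_inner M f h"
  using assms by (simp add: L2_inner_commute[of M f] L2_inner_diff_left)

lemma L2_inner_cmult_right: "L2_inner M f (\<lambda>x. a * g x) = a * L2_inner M f g"
  by (simp add: L2_inner_commute[of M f] L2_inner_cmult_left)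

lemma L2_inner_divide_right: "L2_inner M f (\<lambda>x. g x / a) = L2_inner M f g / a"
  by (simp add: L2_inner_def)

lemmas L2_inner_bilinear =
  L2_inner_add_left L2_inner_diff_left L2_inner_cmult_left L2_inner_divide_left
  L2_inner_add_right L2_inner_diff_right L2_inner_cmult_right L2_inner_divide_right

lemma L2_norm_add_power2:
  assumes "f \<in> L2 M" "g \<in> L2 M"
  shows "(L2_norm M (\<lambda>x. f x + g x))\<^sup>2
    = (L2_norm M f)\<^sup>2 + 2 * L2_inner M f g + (L2_norm M g)\<^sup>2"
  using assms by (simp add: L2_norm_power2 L2_inner_bilinear L2_inner_commute[of M g f])

lemma L2_norm_diff_power2:
  assumes "f \<in> L2 M" "g \<in> L2 M"
  shows "(L2_norm M (\<lambda>x. f x - g x))\<^sup>2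
    = (L2_norm M f)\<^sup>2 - 2 * L2_inner M f g + (L2_norm M g)\<^sup>2"
  using assms by (simp add: L2_norm_power2 L2_inner_bilinear L2_inner_commute[of M g f])

lemma L2_norm_cmult: "L2_norm M (\<lambda>x. a * f x) = \<bar>a\<bar> * L2_norm M f"
  by (simp add: L2_norm_def L2_inner_bilinear real_sqrt_mult flip: mult.assoc)

lemma L2_norm_abs [simp]: "L2_norm M (\<lambda>x. \<bar>f x\<bar>) = L2_norm M f"
  by (simp add: L2_norm_def L2_inner_def)

lemma L2_inner_mono:
  assumes "f \<in> L2 M" "g \<in> L2 M" "f' \<in> L2 M" "g' \<in> L2 M"
    and "AE x in M. f x * g x \<le> f' x * g' x"
  shows "L2_inner M f g \<le> L2_inner M f' g'"
  unfolding L2_inner_def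
  using assms by (intro integral_mono_AE L2_mult_integrable) auto

lemma L2_inner_nonneg:
  assumes "AE x in M. 0 \<le> f x" "AE x in M. 0 \<le> g x"
  shows "0 \<le> L2_inner M f g"
  unfolding L2_inner_def using assms by (intro integral_nonneg_AE) auto

lemma L2_inner_cong_AE:
  assumes "f \<in> L2 M" "g \<in> L2 M" "f' \<in> L2 M" "g' \<in> L2 M"
    and "AE x in M. f x = f' x" "AE x in M. g x = g' x"
  shows "L2_inner M f g = L2_inner M f' g'"
  unfolding L2_inner_def
  using assms by (intro integral_cong_AE borel_measurable_times) (auto dest: L2_measurable)

lemma L2_norm_mono:
  assumes "f \<in> L2 M" "g \<in> L2 M" "AE x in M. \<bar>f x\<bar> \<le> \<bar>g x\<bar>"
  shows "L2_norm M f \<le> L2_norm M g"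
  unfolding L2_norm_def
proof (intro real_sqrt_le_mono L2_inner_mono)
  show "AE x in M. f x * f x \<le> g x * g x"
    using assms(3) by (auto simp: abs_le_square_iff simp flip: power2_eq_square)
qed (use assms in auto)

lemma L2_norm_cong_AE:
  assumes "f \<in> L2 M" "g \<in> L2 M" "AE x in M. f x = g x"
  shows "L2_norm M f = L2_norm M g"
  unfolding L2_norm_def by (simp add: L2_inner_cong_AE[OF assms(1,1,2,2,3,3)])

lemma L2_norm_eq_0_AE:
  assumes "f \<in> L2 M" "L2_norm M f = 0"
  shows "AE x in M. f x = 0"
  using integral_nonneg_eq_0_iff_AE[OF L2_integrable_square[OF assms(1)]] assms(2)
  by (simp add: L2_norm_def L2_inner_self)

lemma L2_eqI_AE:
  assumes "u \<in> L2 M" "v \<in> L2 M" and "\<And>h. h \<in> L2 M \<Longrightarrow> L2_inner M u h = L2_inner M v h"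
  shows "AE x in M. u x = v x"
proof -
  have "L2_norm M (\<lambda>x. u x - v x) = 0"
    using assms by (simp add: L2_norm_def L2_inner_diff_left)
  then show ?thesis using L2_norm_eq_0_AE[of "\<lambda>x. u x - v x" M] assms by simp
qed

lemma quadratic_nonneg_imp_discriminant_le:
  fixes a b c :: real
  assumes nonneg: "\<And>t. 0 \<le> a + 2 * t * b + t\<^sup>2 * c" and "0 \<le> c"
  shows "b\<^sup>2 \<le> a * c"
proof (cases "c = 0")
  case True
  have "b = 0"
  proof (rule ccontr)
    assume "b \<noteq> 0"
    then show False using nonneg[of "- (a + 1) / (2 * b)"] True by (simp add: field_simps)
  qed
  then show ?thesis using True by simp
next
  case False
  have "a + 2 * (- b / c) * b + (- b / c)\<^sup>2 * c = a - b\<^sup>2 / c"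
    using False by (simp add: power2_eq_square field_simps)
  then have "0 \<le> a - b\<^sup>2 / c" using nonneg[of "- b / c"] by simp
  then show ?thesis using \<open>0 \<le> c\<close> False by (simp add: field_simps)
qed

lemma L2_Cauchy_Schwarz:
  assumes "f \<in> L2 M" "g \<in> L2 M"
  shows "\<bar>L2_inner M f g\<bar> \<le> L2_norm M f * L2_norm M g"
proof -
  have "0 \<le> (L2_norm M f)\<^sup>2 + 2 * t * L2_inner M f g + t\<^sup>2 * (L2_norm M g)\<^sup>2" for t
    using zero_le_power2[of "L2_norm M (\<lambda>x. f x + t * g x)"] assms
    by (simp add: L2_norm_add_power2 L2_inner_cmult_right L2_norm_cmult power_mult_distrib
        mult.assoc)
  then have "(L2_inner M f g)\<^sup>2 \<le> (L2_norm M f * L2_norm M g)\<^sup>2"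
    unfolding power_mult_distrib by (rule quadratic_nonneg_imp_discriminant_le) simp
  then show ?thesis by (simp add: abs_le_square_iff[symmetric] abs_mult)
qed

lemma L2_norm_triangle:
  assumes "f \<in> L2 M" "g \<in> L2 M"
  shows "L2_norm M (\<lambda>x. f x + g x) \<le> L2_norm M f + L2_norm M g"
proof (rule power2_le_imp_le)
  show "(L2_norm M (\<lambda>x. f x + g x))\<^sup>2 \<le> (L2_norm M f + L2_norm M g)\<^sup>2"
    using L2_Cauchy_Schwarz[OF assms] by (simp add: L2_norm_add_power2 assms power2_sum)
qed simp

lemma L2_norm_triangle_diff:
  assumes "f \<in> L2 M" "g \<in> L2 M" "h \<in> L2 M"
  shows "L2_norm M (\<lambda>x. f x - h x) \<le> L2_norm M (\<lambda>x. f x - g x) + L2_norm M (\<lambda>x. g x - h x)"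
  using L2_norm_triangle[of "\<lambda>x. f x - g x" M "\<lambda>x. g x - h x"] assms by simp

lemma L2_inner_tendsto:
  assumes "\<And>n. u n \<in> L2 M" "v \<in> L2 M" "g \<in> L2 M"
    and "(\<lambda>n. L2_norm M (\<lambda>x. u n x - v x)) \<longlonglongrightarrow> 0"
  shows "(\<lambda>n. L2_inner M (u n) g) \<longlonglongrightarrow> L2_inner M v g"
proof -
  have "norm (L2_inner M (u n) g - L2_inner M v g)
      \<le> L2_norm M (\<lambda>x. u n x - v x) * L2_norm M g" for n
    using L2_Cauchy_Schwarz[of "\<lambda>x. u n x - v x" M g] assms(1-3) by (simp add: L2_inner_diff_left)
  moreover have "(\<lambda>n. L2_norm M (\<lambda>x. u n x - v x) * L2_norm M g) \<longlonglongrightarrow> 0"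
    by (rule tendsto_mult_left_zero[OF assms(4)])
  ultimately have "(\<lambda>n. L2_inner M (u n) g - L2_inner M v g) \<longlonglongrightarrow> 0"
    by (rule Lim_null_comparison[OF always_eventually[OF allI]])
  then show ?thesis by (simp add: LIM_zero_iff)
qed

lemma L2_Fatou:
  assumes u: "\<And>n. u n \<in> L2 M" and [measurable]: "v \<in> borel_measurable M"
    and lim: "AE x in M. (\<lambda>n. u n x) \<longlonglongrightarrow> v x"
    and bound: "\<And>n. L2_norm M (u n) \<le> C"
  shows "v \<in> L2 M" "L2_norm M v \<le> C"
proof -
  have "0 \<le> C" using bound[of 0] L2_norm_nonneg[of M "u 0"] by linarith
  have [measurable]: "u n \<in> borel_measurable M" for n using u by (rule L2_measurable)
  have square_le: "(\<integral>\<^sup>+x. ennreal ((u n x)\<^sup>2) \<partial>M) \<le> ennreal (C\<^sup>2)" for n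
    using power_mono[OF bound[of n] L2_norm_nonneg, of 2] L2_integrable_square[OF u[of n]]
    by (simp add: nn_integral_eq_integral L2_norm_power2 L2_inner_self ennreal_leI)
  have "AE x in M. ennreal ((v x)\<^sup>2) = liminf (\<lambda>n. ennreal ((u n x)\<^sup>2))"
    using lim
  proof eventually_elim
    case (elim x)
    then have "(\<lambda>n. ennreal ((u n x)\<^sup>2)) \<longlonglongrightarrow> ennreal ((v x)\<^sup>2)"
      by (intro tendsto_ennrealI tendsto_power)
    then show ?case using lim_imp_Liminf[OF sequentially_bot] by metis
  qed
  then have "(\<integral>\<^sup>+x. ennreal ((v x)\<^sup>2) \<partial>M) = (\<integral>\<^sup>+x. liminf (\<lambda>n. ennreal ((u n x)\<^sup>2)) \<partial>M)"
    by (rule nn_integral_cong_AE)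
  also have "\<dots> \<le> liminf (\<lambda>n. \<integral>\<^sup>+x. ennreal ((u n x)\<^sup>2) \<partial>M)"
    by (rule nn_integral_liminf) measurable
  also have "\<dots> \<le> liminf (\<lambda>n. ennreal (C\<^sup>2))"
    using square_le by (intro Liminf_mono always_eventually) auto
  finally have square_bound: "(\<integral>\<^sup>+x. ennreal ((v x)\<^sup>2) \<partial>M) \<le> ennreal (C\<^sup>2)"
    by (simp add: Liminf_const)
  then have square_integrable: "integrable M (\<lambda>x. (v x)\<^sup>2)"
    by (intro integrableI_bounded) (auto simp: le_less_trans)
  then show "v \<in> L2 M" by (simp add: L2_def)
  have "(L2_norm M v)\<^sup>2 \<le> C\<^sup>2"
    using square_bound square_integrable
    by (simp add: nn_integral_eq_integral L2_norm_power2 L2_inner_self)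
  then show "L2_norm M v \<le> C" using \<open>0 \<le> C\<close> by (rule power2_le_imp_le)
qed

definition L2_Cauchy :: "'a measure \<Rightarrow> (nat \<Rightarrow> 'a \<Rightarrow> real) \<Rightarrow> bool" where
  "L2_Cauchy M u \<longleftrightarrow>
    (\<forall>e>0. \<exists>N. \<forall>i\<ge>N. \<forall>j\<ge>N. L2_norm M (\<lambda>x. u i x - u j x) < e)"

lemma L2_Cauchy_limit_of_AE_subseq:
  assumes u: "\<And>n. u n \<in> L2 M" and Cauchy: "L2_Cauchy M u" and r: "strict_mono r"
    and [measurable]: "v \<in> borel_measurable M" and lim: "AE x in M. (\<lambda>i. u (r i) x) \<longlonglongrightarrow> v x"
  shows "v \<in> L2 M" "(\<lambda>n. L2_norm M (\<lambda>x. u n x - v x)) \<longlonglongrightarrow> 0"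
proof -
  have [measurable]: "u n \<in> borel_measurable M" for n using u by (rule L2_measurable)
  have close: "\<exists>N. \<forall>n\<ge>N. (\<lambda>x. u n x - v x) \<in> L2 M \<and> L2_norm M (\<lambda>x. u n x - v x) \<le> e"
    if "e > 0" for e
  proof -
    obtain N where N: "\<And>i j. i \<ge> N \<Longrightarrow> j \<ge> N \<Longrightarrow> L2_norm M (\<lambda>x. u i x - u j x) < e"
      using Cauchy \<open>e > 0\<close> unfolding L2_Cauchy_def by blast
    have "(\<lambda>x. u n x - v x) \<in> L2 M \<and> L2_norm M (\<lambda>x. u n x - v x) \<le> e" if "n \<ge> N" for n
    proof -
      let ?w = "\<lambda>i x. u n x - u (r (i + N)) x"
      have "?w i \<in> L2 M" for i by (simp add: u)
      moreover have "AE x in M. (\<lambda>i. ?w i x) \<longlonglongrightarrow> u n x - v x"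
        using lim
        by eventually_elim (intro tendsto_diff tendsto_const LIMSEQ_ignore_initial_segment)
      moreover have "L2_norm M (?w i) \<le> e" for i
        using N[OF \<open>n \<ge> N\<close>, of "r (i + N)"] seq_suble[OF r, of "i + N"] by simp
      ultimately show ?thesis
        using L2_Fatou[of ?w M "\<lambda>x. u n x - v x" e] by simp
    qed
    then show ?thesis by blast
  qed
  obtain N where "(\<lambda>x. u N x - v x) \<in> L2 M" using close[of 1] by auto
  from L2_diff[OF u[of N] this] show "v \<in> L2 M" by simp
  show "(\<lambda>n. L2_norm M (\<lambda>x. u n x - v x)) \<longlonglongrightarrow> 0"
    using close by (intro LIMSEQ_I) (metis L2_norm_nonneg abs_of_nonneg diff_zero dense
        le_less_trans real_norm_def)
qed

definition L2_subspace :: "'a measure \<Rightarrow> ('a \<Rightarrow> real) set \<Rightarrow> bool" where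
  "L2_subspace M V \<longleftrightarrow> V \<subseteq> L2 M \<and> (\<lambda>_. 0) \<in> V \<and>
    (\<forall>f\<in>V. \<forall>g\<in>V. \<forall>a. (\<lambda>x. f x + a * g x) \<in> V)"

lemma minimizer_almost_orthogonal:
  assumes V: "L2_subspace M V" and F: "F \<in> L2 M" and g: "g \<in> V" and h: "h \<in> V" and "0 \<le> \<epsilon>"
    and lower: "\<And>k. k \<in> V \<Longrightarrow> d \<le> (L2_norm M (\<lambda>x. F x - k x))\<^sup>2"
    and near: "(L2_norm M (\<lambda>x. F x - g x))\<^sup>2 \<le> d + \<epsilon>\<^sup>2"
  shows "\<bar>L2_inner M (\<lambda>x. F x - g x) h\<bar> \<le> \<epsilon> * L2_norm M h"
proof -
  let ?u = "\<lambda>x. F x - g x"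
  have [simp]: "g \<in> L2 M" "h \<in> L2 M" using V g h by (auto simp: L2_subspace_def)
  have "0 \<le> \<epsilon>\<^sup>2 + 2 * t * L2_inner M ?u h + t\<^sup>2 * (L2_norm M h)\<^sup>2" for t
  proof -
    have "(\<lambda>x. g x + (- t) * h x) \<in> V" using V g h unfolding L2_subspace_def by blast
    from lower[OF this] have "d \<le> (L2_norm M (\<lambda>x. ?u x + t * h x))\<^sup>2"
      by (simp add: diff_diff_eq2 diff_add_eq)
    also have "\<dots> = (L2_norm M ?u)\<^sup>2 + 2 * t * L2_inner M ?u h + t\<^sup>2 * (L2_norm M h)\<^sup>2"
      using F
      by (simp add: L2_norm_add_power2 L2_inner_cmult_right L2_norm_cmult power_mult_distrib)
    finally show ?thesis using near by linarith
  qed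
  then have "(L2_inner M ?u h)\<^sup>2 \<le> (\<epsilon> * L2_norm M h)\<^sup>2"
    unfolding power_mult_distrib by (rule quadratic_nonneg_imp_discriminant_le) simp
  then show ?thesis using \<open>0 \<le> \<epsilon>\<close> by (simp add: abs_le_square_iff[symmetric] abs_mult)
qed

lemma almost_orthogonal_residuals_Cauchy:
  assumes V: "L2_subspace M V" and F: "F \<in> L2 M" and g: "\<And>n. g n \<in> V"
    and orth: "\<And>n h. h \<in> V \<Longrightarrow>
      \<bar>L2_inner M (\<lambda>x. F x - g n x) h\<bar> \<le> inverse (real (Suc n)) * L2_norm M h"
  shows "L2_Cauchy M (\<lambda>n x. F x - g n x)"
proof -
  let ?u = "\<lambda>n x. F x - g n x" and ?e = "\<lambda>n. inverse (real (Suc n))"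
  have [simp]: "h \<in> V \<Longrightarrow> h \<in> L2 M" for h using V by (auto simp: L2_subspace_def)
  have diff_le: "L2_norm M (\<lambda>x. ?u i x - ?u j x) \<le> ?e i + ?e j" for i j
  proof -
    define h where "h = (\<lambda>x. g j x + (- 1) * g i x)"
    have h: "h \<in> V" using V g unfolding L2_subspace_def h_def by blast
    have h_eq: "h = (\<lambda>x. ?u i x - ?u j x)" by (auto simp: h_def)
    have "(L2_norm M h)\<^sup>2 = L2_inner M (\<lambda>x. ?u i x - ?u j x) h"
      by (simp only: L2_norm_power2 h_eq[symmetric])
    also have "\<dots> = L2_inner M (?u i) h - L2_inner M (?u j) h"
      by (rule L2_inner_diff_left) (use F g h in simp_all)
    also have "\<dots> \<le> (?e i + ?e j) * L2_norm M h"
      using orth[OF h, of i] orth[OF h, of j] by (simp add: distrib_right)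
    finally have "L2_norm M h * L2_norm M h \<le> (?e i + ?e j) * L2_norm M h"
      by (simp add: power2_eq_square)
    then have "L2_norm M h \<le> ?e i + ?e j"
      using L2_norm_nonneg[of M h] by (cases "L2_norm M h = 0") auto
    then show ?thesis by (simp only: h_eq)
  qed
  show ?thesis
    unfolding L2_Cauchy_def
  proof (intro allI impI)
    fix e :: real assume "e > 0"
    then have "eventually (\<lambda>n. ?e n < e / 2) sequentially"
      by (intro order_tendstoD(2)[OF LIMSEQ_inverse_real_of_nat]) simp
    then obtain N where "\<And>n. n \<ge> N \<Longrightarrow> ?e n < e / 2" by (auto simp: eventually_sequentially)
    then show "\<exists>N. \<forall>i\<ge>N. \<forall>j\<ge>N. L2_norm M (\<lambda>x. ?u i x - ?u j x) < e"
      using diff_le by (smt (verit) field_sum_of_halves)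
  qed
qed

lemma truncations_tendsto_L1:
  fixes f :: "'a \<Rightarrow> real"
  assumes f: "integrable M f"
  shows "(\<lambda>n. integral\<^sup>L M (\<lambda>x. \<bar>max (- real n) (min (f x) (real n)) - f x\<bar>)) \<longlonglongrightarrow> 0"
proof -
  let ?d = "\<lambda>n x. \<bar>max (- real n) (min (f x) (real n)) - f x\<bar>"
  have "(\<lambda>n. integral\<^sup>L M (?d n)) \<longlonglongrightarrow> integral\<^sup>L M (\<lambda>x. 0)"
  proof (rule integral_dominated_convergence[where w = "\<lambda>x. \<bar>f x\<bar>"])
    show "AE x in M. (\<lambda>n. ?d n x) \<longlonglongrightarrow> 0"
    proof (rule AE_I2)
      fix x
      have "eventually (\<lambda>n. ?d n x = 0) sequentially"
        using eventually_ge_at_top[of "nat \<lceil>\<bar>f x\<bar>\<rceil>"]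
        by eventually_elim (auto simp: nat_ceiling_le_eq)
      then show "(\<lambda>n. ?d n x) \<longlonglongrightarrow> 0" by (rule tendsto_eventually)
    qed
    show "AE x in M. norm (?d n x) \<le> \<bar>f x\<bar>" for n by auto
  qed (use f in auto)
  then show ?thesis by simp
qed

context finite_measure
begin

lemma L2_const [simp]: "(\<lambda>_. c) \<in> L2 M"
  by (simp add: L2_def)

lemma L2_bounded:
  assumes "f \<in> borel_measurable M" "AE x in M. \<bar>f x\<bar> \<le> K"
  shows "f \<in> L2 M"
  by (rule L2_dominated[OF L2_const[of K]]) (use assms in auto)

lemma L2_integrable:
  assumes "f \<in> L2 M"
  shows "integrable M f"
  using L2_mult_integrable[OF assms L2_const[of 1]] by simp

lemma L1_norm_le_L2_norm:
  assumes "f \<in> L2 M"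
  shows "integral\<^sup>L M (\<lambda>x. \<bar>f x\<bar>) \<le> L2_norm M f * L2_norm M (\<lambda>_. 1)"
  using L2_Cauchy_Schwarz[OF L2_abs[OF assms] L2_const[of 1]] by (simp add: L2_inner_def)

lemma integral_pos_part_diff_le:
  assumes f: "f \<in> L2 M" and "R > 0"
  shows "integral\<^sup>L M (\<lambda>x. pos_part (f x - R)) \<le> (L2_norm M f)\<^sup>2 / R"
proof -
  have "pos_part (t - R) \<le> t\<^sup>2 / R" for t
  proof -
    have "R * (t - R) = t\<^sup>2 - (t - R / 2)\<^sup>2 - 3 / 4 * R\<^sup>2"
      by (simp add: power2_eq_square field_simps)
    then have "R * (t - R) \<le> t\<^sup>2"
      using zero_le_power2[of "t - R / 2"] zero_le_power2[of R] by linarith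
    then show ?thesis using \<open>R > 0\<close> by (simp add: pos_part_def max_def le_divide_eq mult.commute)
  qed
  then have "integral\<^sup>L M (\<lambda>x. pos_part (f x - R)) \<le> integral\<^sup>L M (\<lambda>x. (f x)\<^sup>2 / R)"
    using f by (intro integral_mono L2_integrable integrable_divide L2_integrable_square) auto
  then show ?thesis by (simp add: L2_norm_power2 L2_inner_self)
qed

lemma L2_norm_le_of_L1_limit:
  assumes u: "\<And>n. u n \<in> L2 M" and v: "v \<in> L2 M" and bound: "\<And>n. L2_norm M (u n) \<le> C"
    and lim: "(\<lambda>n. integral\<^sup>L M (\<lambda>x. \<bar>u n x - v x\<bar>)) \<longlonglongrightarrow> 0"
  shows "L2_norm M v \<le> C"
proof -
  obtain r :: "nat \<Rightarrow> nat" where "AE x in M. (\<lambda>n. u (r n) x - v x) \<longlonglongrightarrow> 0"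
    using tendsto_L1_AE_subseq[of M "\<lambda>n x. u n x - v x"] L2_integrable[OF L2_diff[OF u v]] lim
    by auto
  then have "AE x in M. (\<lambda>n. u (r n) x) \<longlonglongrightarrow> v x" by (simp add: LIM_zero_iff)
  then show ?thesis using L2_Fatou(2)[OF u L2_measurable[OF v] _ bound] by blast
qed

lemma L2_complete:
  assumes u: "\<And>n. u n \<in> L2 M" and Cauchy: "L2_Cauchy M u"
  obtains v where "v \<in> L2 M" "(\<lambda>n. L2_norm M (\<lambda>x. u n x - v x)) \<longlonglongrightarrow> 0"
proof -
  have [measurable]: "u n \<in> borel_measurable M" for n using u by (rule L2_measurable)
  obtain r where r: "strict_mono r" and subseq: "AE x in M. Cauchy (\<lambda>i. u (r i) x)"
  proof (rule cauchy_L1_AE_cauchy_subseq[of M u])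
    show "integrable M (u n)" for n using u by (rule L2_integrable)
    fix e :: real assume "e > 0"
    define A where "A = L2_norm M (\<lambda>_. 1) + 1"
    have "A > 0" by (simp add: A_def add_nonneg_pos)
    then obtain N where N: "\<And>i j. i \<ge> N \<Longrightarrow> j \<ge> N \<Longrightarrow> L2_norm M (\<lambda>x. u i x - u j x) < e / A"
      using Cauchy \<open>e > 0\<close> unfolding L2_Cauchy_def by (metis divide_pos_pos)
    have "integral\<^sup>L M (\<lambda>x. norm (u i x - u j x)) < e" if "i \<ge> N" "j \<ge> N" for i j
    proof -
      have "integral\<^sup>L M (\<lambda>x. \<bar>u i x - u j x\<bar>)
          \<le> L2_norm M (\<lambda>x. u i x - u j x) * L2_norm M (\<lambda>_. 1)"
        by (simp add: L1_norm_le_L2_norm u)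
      also have "\<dots> \<le> L2_norm M (\<lambda>x. u i x - u j x) * A"
        by (simp add: A_def mult_left_mono)
      finally show ?thesis using N[OF that] \<open>A > 0\<close> by (simp add: pos_less_divide_eq)
    qed
    then show "\<exists>N. \<forall>i\<ge>N. \<forall>j\<ge>N. integral\<^sup>L M (\<lambda>x. norm (u i x - u j x)) < e" by blast
  qed auto
  define v where "v x = lim (\<lambda>i. u (r i) x)" for x
  have "v \<in> borel_measurable M" unfolding v_def by measurable
  moreover have "AE x in M. (\<lambda>i. u (r i) x) \<longlonglongrightarrow> v x"
    using subseq by eventually_elim (auto simp: v_def Cauchy_convergent_iff convergent_LIMSEQ_iff)
  ultimately show ?thesis using L2_Cauchy_limit_of_AE_subseq[OF u Cauchy r] that by blast
qed

lemma L2_minimizing_sequence: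
  assumes V: "L2_subspace M V" and F: "F \<in> L2 M"
  obtains g where "\<And>n. g n \<in> V"
    "\<And>n h. h \<in> V \<Longrightarrow>
      \<bar>L2_inner M (\<lambda>x. F x - g n x) h\<bar> \<le> inverse (real (Suc n)) * L2_norm M h"
proof -
  define D where "D g = (L2_norm M (\<lambda>x. F x - g x))\<^sup>2" for g
  have nonempty: "V \<noteq> {}" and bdd: "bdd_below (D ` V)"
    using V by (auto simp: L2_subspace_def D_def intro!: bdd_belowI[of _ 0])
  have "\<exists>g\<in>V. D g < (INF k\<in>V. D k) + (inverse (real (Suc n)))\<^sup>2" for n
    using cINF_less_iff[OF nonempty bdd, of "(INF k\<in>V. D k) + (inverse (real (Suc n)))\<^sup>2"] by simp
  then obtain g where g: "\<And>n. g n \<in> V"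
    and near: "\<And>n. D (g n) < (INF k\<in>V. D k) + (inverse (real (Suc n)))\<^sup>2" by metis
  have "\<bar>L2_inner M (\<lambda>x. F x - g n x) h\<bar> \<le> inverse (real (Suc n)) * L2_norm M h"
    if "h \<in> V" for n h
  proof (rule minimizer_almost_orthogonal[OF V F g that])
    show "(INF k\<in>V. D k) \<le> (L2_norm M (\<lambda>x. F x - k x))\<^sup>2" if "k \<in> V" for k
      using cINF_lower[OF bdd that] by (simp add: D_def)
    show "(L2_norm M (\<lambda>x. F x - g n x))\<^sup>2 \<le> (INF k\<in>V. D k) + (inverse (real (Suc n)))\<^sup>2"
      using near[of n] by (simp add: D_def)
  qed simp
  then show ?thesis using g that by blast
qed

lemma L2_orthogonal_residual:
  assumes V: "L2_subspace M V" and F: "F \<in> L2 M"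
  obtains v where "v \<in> L2 M" "\<And>h. h \<in> V \<Longrightarrow> L2_inner M v h = 0"
    "\<And>\<kappa>. \<kappa> > 0 \<Longrightarrow> \<exists>g\<in>V. L2_norm M (\<lambda>x. (F x - g x) - v x) < \<kappa>"
proof -
  obtain g where g: "\<And>n. g n \<in> V"
    and orth: "\<And>n h. h \<in> V \<Longrightarrow>
      \<bar>L2_inner M (\<lambda>x. F x - g n x) h\<bar> \<le> inverse (real (Suc n)) * L2_norm M h"
    using L2_minimizing_sequence[OF V F] by blast
  have V_L2: "h \<in> V \<Longrightarrow> h \<in> L2 M" for h using V by (auto simp: L2_subspace_def)
  let ?u = "\<lambda>n x. F x - g n x"
  have u: "?u n \<in> L2 M" for n using F g by (simp add: V_L2)
  obtain v where v: "v \<in> L2 M" and lim: "(\<lambda>n. L2_norm M (\<lambda>x. ?u n x - v x)) \<longlonglongrightarrow> 0"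
    using L2_complete[of ?u] u almost_orthogonal_residuals_Cauchy[OF V F g orth] by blast
  show ?thesis
  proof (rule that[OF v])
    fix h assume "h \<in> V"
    have "(\<lambda>n. L2_inner M (?u n) h) \<longlonglongrightarrow> 0"
      by (rule Lim_null_comparison[OF _
            tendsto_mult_left_zero[OF LIMSEQ_inverse_real_of_nat, of "L2_norm M h"]])
        (use orth[OF \<open>h \<in> V\<close>] in simp)
    then show "L2_inner M v h = 0"
      using L2_inner_tendsto[OF u v V_L2[OF \<open>h \<in> V\<close>] lim] LIMSEQ_unique by blast
  next
    fix \<kappa> :: real assume "\<kappa> > 0"
    then have "eventually (\<lambda>n. L2_norm M (\<lambda>x. ?u n x - v x) < \<kappa>) sequentially"
      by (rule order_tendstoD(2)[OF lim])
    then show "\<exists>g\<in>V. L2_norm M (\<lambda>x. (F x - g x) - v x) < \<kappa>"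
      using g eventually_happens by fastforce
  qed
qed

end

context prob_space
begin

lemma L2_inner_const: "L2_inner M f (\<lambda>_. c) = c * expectation f"
  by (simp add: L2_inner_def)

lemma L2_norm_const [simp]: "L2_norm M (\<lambda>_. c) = \<bar>c\<bar>"
  by (simp add: L2_norm_def L2_inner_def prob_space)

lemma L2_variance_eq: "f \<in> L2 M \<Longrightarrow> variance f = (L2_norm M f)\<^sup>2 - (expectation f)\<^sup>2"
  by (simp add: variance_eq L2_integrable L2_integrable_square L2_norm_power2 L2_inner_self)

lemma sqrt_variance_eq: "sqrt (variance f) = L2_norm M (\<lambda>x. f x - expectation f)"
  by (simp add: L2_norm_def L2_inner_self)

lemma sqrt_variance_le:
  assumes "f \<in> L2 M"
  shows "sqrt (variance f) \<le> L2_norm M (\<lambda>x. f x - c)"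
proof (rule real_le_lsqrt)
  have "(L2_norm M (\<lambda>x. f x - c))\<^sup>2 = variance f + (expectation f - c)\<^sup>2"
    unfolding L2_variance_eq[OF assms] using assms
    by (simp add: L2_norm_diff_power2 L2_inner_const power2_diff)
  then show "variance f \<le> (L2_norm M (\<lambda>x. f x - c))\<^sup>2" by simp
qed simp

lemma sqrt_variance_triangle:
  assumes "f \<in> L2 M" "g \<in> L2 M"
  shows "sqrt (variance f) \<le> sqrt (variance g) + L2_norm M (\<lambda>x. f x - g x)"
  using sqrt_variance_le[OF assms(1), of "expectation g"]
    L2_norm_triangle_diff[OF assms L2_const[of "expectation g"]]
  by (simp add: sqrt_variance_eq)

end

section \<open>Markov operators with an invariant probability measure\<close>

locale markov_L2 = prob_space M for M :: "'a measure" +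
  fixes P :: "('a \<Rightarrow> real) \<Rightarrow> ('a \<Rightarrow> real)"
  assumes markov: "markov_operator M P"
    and invariant: "invariant_measure M P"

lemma (in prob_space) markov_L2I:
  assumes "\<And>f. f \<in> L2 M \<Longrightarrow> P f \<in> L2 M"
    and "\<And>f g. f \<in> L2 M \<Longrightarrow> g \<in> L2 M \<Longrightarrow> AE x in M. f x = g x \<Longrightarrow> AE x in M. P f x = P g x"
    and "\<And>f g a b. f \<in> L2 M \<Longrightarrow> g \<in> L2 M \<Longrightarrow>
      AE x in M. P (\<lambda>y. a * f y + b * g y) x = a * P f x + b * P g x"
    and "AE x in M. P (\<lambda>_. 1) x = 1"
    and "\<And>f. f \<in> L2 M \<Longrightarrow> AE x in M. 0 \<le> f x \<Longrightarrow> AE x in M. 0 \<le> P f x"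
    and "\<And>f. f \<in> L2 M \<Longrightarrow> expectation (P f) = expectation f"
  shows "markov_L2 M P"
  by unfold_locales (use assms in \<open>auto simp: markov_operator_def invariant_measure_def\<close>)

context markov_L2
begin

lemma P_L2 [simp]: "f \<in> L2 M \<Longrightarrow> P f \<in> L2 M"
  using markov by (auto simp: markov_operator_def)

lemma P_cong_AE:
  "f \<in> L2 M \<Longrightarrow> g \<in> L2 M \<Longrightarrow> AE x in M. f x = g x \<Longrightarrow> AE x in M. P f x = P g x"
  using markov by (auto simp: markov_operator_def)

lemma P_lincomb:
  "f \<in> L2 M \<Longrightarrow> g \<in> L2 M \<Longrightarrow>
    AE x in M. P (\<lambda>y. a * f y + b * g y) x = a * P f x + b * P g x"
  using markov by (auto simp: markov_operator_def)

lemma P_nonneg: "f \<in> L2 M \<Longrightarrow> AE x in M. 0 \<le> f x \<Longrightarrow> AE x in M. 0 \<le> P f x"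
  using markov by (auto simp: markov_operator_def)

lemma P_1: "AE x in M. P (\<lambda>_. 1) x = 1"
  using markov by (auto simp: markov_operator_def)

lemma expectation_P: "f \<in> L2 M \<Longrightarrow> expectation (P f) = expectation f"
  using invariant by (auto simp: invariant_measure_def)

lemma P_add:
  assumes "f \<in> L2 M" "g \<in> L2 M"
  shows "AE x in M. P (\<lambda>y. f y + g y) x = P f x + P g x"
  using P_lincomb[OF assms, of 1 1] by simp

lemma P_diff:
  assumes "f \<in> L2 M" "g \<in> L2 M"
  shows "AE x in M. P (\<lambda>y. f y - g y) x = P f x - P g x"
  using P_lincomb[OF assms, of 1 "-1"] by simp

lemma P_cmult:
  assumes "f \<in> L2 M"
  shows "AE x in M. P (\<lambda>y. a * f y) x = a * P f x"
  using P_lincomb[OF assms assms, of a 0] by simp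

lemma P_const: "AE x in M. P (\<lambda>_. c) x = c"
  using P_cmult[OF L2_const[of 1], of c] P_1 by auto

lemma P_add_const:
  assumes "f \<in> L2 M"
  shows "AE x in M. P (\<lambda>y. f y + c) x = P f x + c"
  using P_add[OF assms L2_const[of c]] P_const[of c] by auto

lemma P_mono:
  assumes "f \<in> L2 M" "g \<in> L2 M" "AE x in M. f x \<le> g x"
  shows "AE x in M. P f x \<le> P g x"
  using P_nonneg[OF L2_diff[OF assms(2,1)]] P_diff[OF assms(2,1)] assms(3) by auto

lemma P_abs:
  assumes f: "f \<in> L2 M"
  shows "AE x in M. \<bar>P f x\<bar> \<le> P (\<lambda>y. \<bar>f y\<bar>) x"
proof -
  have "AE x in M. P (\<lambda>y. (-1) * f y) x \<le> P (\<lambda>y. \<bar>f y\<bar>) x"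
    by (intro P_mono L2_cmult L2_abs f) auto
  moreover have "AE x in M. P f x \<le> P (\<lambda>y. \<bar>f y\<bar>) x"
    by (intro P_mono L2_abs f) auto
  ultimately show ?thesis using P_cmult[OF f, of "-1"] by auto
qed

lemma P_bounded:
  assumes f: "f \<in> L2 M" and bound: "AE x in M. \<bar>f x\<bar> \<le> K"
  shows "AE x in M. \<bar>P f x\<bar> \<le> K"
  using P_abs[OF f] P_mono[OF L2_abs[OF f] L2_const[of K] bound] P_const[of K] by auto

lemma P_Jensen_square:
  assumes f: "f \<in> L2 M" and square_L2: "(\<lambda>x. (f x)\<^sup>2) \<in> L2 M"
  shows "AE x in M. (P f x)\<^sup>2 \<le> P (\<lambda>y. (f y)\<^sup>2) x"
proof -
  have tangent: "AE x in M. 2 * q * P f x - q\<^sup>2 \<le> P (\<lambda>y. (f y)\<^sup>2) x" for q :: real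
  proof -
    have "2 * q * t + (- (q\<^sup>2)) \<le> t\<^sup>2" for t :: real
      using zero_le_power2[of "t - q"] by (simp add: power2_eq_square algebra_simps)
    then have "AE x in M. P (\<lambda>y. 2 * q * f y + (- (q\<^sup>2))) x \<le> P (\<lambda>y. (f y)\<^sup>2) x"
      by (intro P_mono L2_add L2_cmult f L2_const square_L2) auto
    then show ?thesis
      using P_add_const[OF L2_cmult[OF f, of "2 * q"], of "- (q\<^sup>2)"] P_cmult[OF f, of "2 * q"]
      by auto
  qed
  have "AE x in M. \<forall>q\<in>\<rat>. 2 * q * P f x - q\<^sup>2 \<le> P (\<lambda>y. (f y)\<^sup>2) x"
    using tangent by (subst AE_ball_countable) (auto intro: countable_rat)
  then show ?thesis
  proof eventually_elim
    case (elim x)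
    show ?case
    proof (rule ccontr)
      assume "\<not> ?thesis"
      then have gap: "0 < (P f x)\<^sup>2 - P (\<lambda>y. (f y)\<^sup>2) x" (is "0 < ?d") by simp
      obtain q where q: "q \<in> \<rat>" "P f x < q" "q < P f x + sqrt ?d"
        using Rats_dense_in_real[of "P f x" "P f x + sqrt ?d"] gap by auto
      then have "(q - P f x)\<^sup>2 < (sqrt ?d)\<^sup>2" by (intro power_strict_mono) auto
      then have "(q - P f x)\<^sup>2 < ?d" using gap by simp
      with elim q(1) show False by (auto simp: power2_eq_square algebra_simps)
    qed
  qed
qed

lemma L1_norm_P_le:
  assumes f: "f \<in> L2 M"
  shows "expectation (\<lambda>x. \<bar>P f x\<bar>) \<le> expectation (\<lambda>x. \<bar>f x\<bar>)"
proof -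
  have "expectation (\<lambda>x. \<bar>P f x\<bar>) \<le> expectation (P (\<lambda>x. \<bar>f x\<bar>))"
    using P_abs[OF f] by (intro integral_mono_AE L2_integrable L2_abs P_L2 f) auto
  then show ?thesis by (simp add: expectation_P f)
qed

lemma L2_norm_P_le_bounded:
  assumes [measurable]: "f \<in> borel_measurable M" and bound: "\<And>x. \<bar>f x\<bar> \<le> K"
  shows "L2_norm M (P f) \<le> L2_norm M f"
proof -
  have f: "f \<in> L2 M" by (rule L2_bounded[where K = K]) (auto simp: bound)
  have square_L2: "(\<lambda>x. (f x)\<^sup>2) \<in> L2 M"
    by (rule L2_bounded[where K = "K\<^sup>2"]) (use power_mono[OF bound abs_ge_zero, of _ 2] in auto)
  have "expectation (\<lambda>x. (P f x)\<^sup>2) \<le> expectation (P (\<lambda>x. (f x)\<^sup>2))"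
    using P_Jensen_square[OF f square_L2]
    by (intro integral_mono_AE L2_integrable_square L2_integrable P_L2 f square_L2)
  then show ?thesis by (simp add: L2_norm_def L2_inner_self expectation_P[OF square_L2])
qed

lemma L2_norm_P_le:
  assumes f: "f \<in> L2 M"
  shows "L2_norm M (P f) \<le> L2_norm M f"
proof -
  have [measurable]: "f \<in> borel_measurable M" using f by (rule L2_measurable)
  define g where "g n x = max (- real n) (min (f x) (real n))" for n :: nat and x
  have g_measurable [measurable]: "g n \<in> borel_measurable M" for n unfolding g_def by measurable
  have g_le: "\<bar>g n x\<bar> \<le> \<bar>f x\<bar>" and g_bounded: "\<bar>g n x\<bar> \<le> real n" for n x
    by (auto simp: g_def)
  have g: "g n \<in> L2 M" for n by (rule L2_dominated[OF f]) (auto simp: g_le)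
  show ?thesis
  proof (rule L2_norm_le_of_L1_limit)
    show "L2_norm M (P (g n)) \<le> L2_norm M f" for n
      using L2_norm_P_le_bounded[OF g_measurable g_bounded] L2_norm_mono[OF g f] g_le
      by (meson AE_I2 order_trans)
    show "(\<lambda>n. expectation (\<lambda>x. \<bar>P (g n) x - P f x\<bar>)) \<longlonglongrightarrow> 0"
    proof (rule Lim_null_comparison[OF always_eventually[OF allI]])
      show "(\<lambda>n. expectation (\<lambda>x. \<bar>g n x - f x\<bar>)) \<longlonglongrightarrow> 0"
        unfolding g_def by (rule truncations_tendsto_L1[OF L2_integrable[OF f]])
      fix n
      have "expectation (\<lambda>x. \<bar>P (g n) x - P f x\<bar>) = expectation (\<lambda>x. \<bar>P (\<lambda>x. g n x - f x) x\<bar>)"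
        using P_diff[OF g[of n] f]
        by (intro integral_cong_AE L2_measurable L2_abs L2_diff P_L2 f g) auto
      then show "norm (expectation (\<lambda>x. \<bar>P (g n) x - P f x\<bar>)) \<le> expectation (\<lambda>x. \<bar>g n x - f x\<bar>)"
        using L1_norm_P_le[OF L2_diff[OF g f], of n] by simp
    qed
  qed (simp_all add: f g)
qed

lemma L2_inner_P_add:
  assumes "f \<in> L2 M" "g \<in> L2 M" "h \<in> L2 M"
  shows "L2_inner M h (P (\<lambda>x. f x + g x)) = L2_inner M h (P f) + L2_inner M h (P g)"
proof -
  have "L2_inner M h (P (\<lambda>x. f x + g x)) = L2_inner M h (\<lambda>x. P f x + P g x)"
    using assms by (intro L2_inner_cong_AE P_add) auto
  then show ?thesis using assms by (simp add: L2_inner_add_right)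
qed

lemma L2_inner_P_cmult:
  assumes "f \<in> L2 M" "h \<in> L2 M"
  shows "L2_inner M h (P (\<lambda>x. a * f x)) = a * L2_inner M h (P f)"
proof -
  have "L2_inner M h (P (\<lambda>x. a * f x)) = L2_inner M h (\<lambda>x. a * P f x)"
    using assms by (intro L2_inner_cong_AE P_cmult) auto
  then show ?thesis by (simp add: L2_inner_cmult_right)
qed

lemma L2_inner_P_diff:
  assumes "f \<in> L2 M" "g \<in> L2 M" "h \<in> L2 M"
  shows "L2_inner M h (P (\<lambda>x. f x - g x)) = L2_inner M h (P f) - L2_inner M h (P g)"
  using assms L2_inner_P_add[of f "\<lambda>x. (-1) * g x" h] L2_inner_P_cmult[of g h "-1"] by simp

lemma L2_inner_P_const:
  assumes "h \<in> L2 M"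
  shows "L2_inner M h (P (\<lambda>_. c)) = c * expectation h"
proof -
  have "L2_inner M h (P (\<lambda>_. c)) = L2_inner M h (\<lambda>_. c)"
    using assms by (intro L2_inner_cong_AE P_const) auto
  then show ?thesis by (simp add: L2_inner_const)
qed

lemma abs_L2_inner_P_le:
  assumes "f \<in> L2 M"
  shows "\<bar>L2_inner M f (P f)\<bar> \<le> (L2_norm M f)\<^sup>2"
proof -
  have "\<bar>L2_inner M f (P f)\<bar> \<le> L2_norm M f * L2_norm M (P f)"
    by (intro L2_Cauchy_Schwarz P_L2 assms)
  also have "\<dots> \<le> L2_norm M f * L2_norm M f"
    by (intro mult_left_mono L2_norm_P_le assms) simp
  finally show ?thesis by (simp add: power2_eq_square)
qed

lemma comp_markov_L2:
  assumes "markov_L2 M Q"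
  shows "markov_L2 M (P \<circ> Q)"
proof (rule markov_L2I)
  interpret Q: markov_L2 M Q by fact
  fix f assume f: "f \<in> L2 M"
  show "(P \<circ> Q) f \<in> L2 M" by (simp add: f)
  show "expectation ((P \<circ> Q) f) = expectation f" by (simp add: f expectation_P Q.expectation_P)
  show "AE x in M. 0 \<le> (P \<circ> Q) f x" if "AE x in M. 0 \<le> f x"
    using P_nonneg[OF Q.P_L2[OF f] Q.P_nonneg[OF f that]] by simp
  fix g assume g: "g \<in> L2 M"
  show "AE x in M. (P \<circ> Q) f x = (P \<circ> Q) g x" if "AE x in M. f x = g x"
    using P_cong_AE[OF Q.P_L2[OF f] Q.P_L2[OF g] Q.P_cong_AE[OF f g that]] by simp
  fix a b
  have "AE x in M. P (Q (\<lambda>y. a * f y + b * g y)) x = P (\<lambda>x. a * Q f x + b * Q g x) x"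
    by (intro P_cong_AE Q.P_lincomb) (simp_all add: f g)
  then show "AE x in M. (P \<circ> Q) (\<lambda>y. a * f y + b * g y) x = a * (P \<circ> Q) f x + b * (P \<circ> Q) g x"
    using P_lincomb[OF Q.P_L2[OF f] Q.P_L2[OF g], of a b] by auto
next
  interpret Q: markov_L2 M Q by fact
  show "AE x in M. (P \<circ> Q) (\<lambda>_. 1) x = 1"
    using P_cong_AE[OF _ _ Q.P_1] P_1 by auto
qed

lemma funpow_markov_L2: "markov_L2 M (P ^^ k)"
proof (induction k)
  case 0
  show ?case by (rule markov_L2I) auto
next
  case (Suc k)
  then show ?case by (simp only: funpow.simps comp_markov_L2)
qed

lemma funpow_L2 [simp]: "f \<in> L2 M \<Longrightarrow> (P ^^ k) f \<in> L2 M"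
  using markov_L2.P_L2[OF funpow_markov_L2] .

lemma L2_norm_funpow_diff_le:
  assumes f: "f \<in> L2 M"
  shows "L2_norm M (\<lambda>x. (P ^^ k) f x - f x) \<le> real k * L2_norm M (\<lambda>x. P f x - f x)"
proof (induction k)
  case 0
  show ?case by simp
next
  case (Suc k)
  let ?d = "\<lambda>x. (P ^^ k) f x - f x"
  have "L2_norm M (\<lambda>x. P ((P ^^ k) f) x - P f x) = L2_norm M (P ?d)"
    using P_diff[OF funpow_L2[OF f] f, of k] by (intro L2_norm_cong_AE) (auto simp: f)
  also have "\<dots> \<le> real k * L2_norm M (\<lambda>x. P f x - f x)"
    using L2_norm_P_le[of ?d] Suc by (simp add: f)
  finally show ?case
    using L2_norm_triangle_diff[of "P ((P ^^ k) f)" M "P f" f] f by (simp add: algebra_simps)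
qed

lemma convex_combination_markov_L2:
  assumes Q: "markov_L2 M Q" and coeffs: "0 \<le> s" "0 \<le> t" "s + t = 1"
  shows "markov_L2 M (\<lambda>f x. s * P f x + t * Q f x)"
proof (rule markov_L2I)
  interpret Q: markov_L2 M Q by fact
  fix f assume f: "f \<in> L2 M"
  show "(\<lambda>x. s * P f x + t * Q f x) \<in> L2 M" by (simp add: f)
  show "expectation (\<lambda>x. s * P f x + t * Q f x) = expectation f"
    using coeffs by (simp add: f L2_integrable expectation_P Q.expectation_P flip: distrib_right)
  show "AE x in M. 0 \<le> s * P f x + t * Q f x" if "AE x in M. 0 \<le> f x"
    using P_nonneg[OF f that] Q.P_nonneg[OF f that] coeffs by auto
  fix g assume g: "g \<in> L2 M"
  show "AE x in M. s * P f x + t * Q f x = s * P g x + t * Q g x" if "AE x in M. f x = g x"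
    using P_cong_AE[OF f g that] Q.P_cong_AE[OF f g that] by auto
  show "AE x in M. s * P (\<lambda>y. a * f y + b * g y) x + t * Q (\<lambda>y. a * f y + b * g y) x
      = a * (s * P f x + t * Q f x) + b * (s * P g x + t * Q g x)" for a b
    using P_lincomb[OF f g, of a b] Q.P_lincomb[OF f g, of a b]
    by eventually_elim (simp add: algebra_simps)
next
  interpret Q: markov_L2 M Q by fact
  show "AE x in M. s * P (\<lambda>_. 1) x + t * Q (\<lambda>_. 1) x = 1"
    using P_1 Q.P_1 coeffs by auto
qed

end

lemma is_adjoint_inner:
  "is_adjoint M P Q \<Longrightarrow> f \<in> L2 M \<Longrightarrow> g \<in> L2 M \<Longrightarrow> L2_inner M g (P f) = L2_inner M (Q g) f"
  by (auto simp: is_adjoint_def L2_inner_def)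

lemma is_adjoint_L2: "is_adjoint M P Q \<Longrightarrow> g \<in> L2 M \<Longrightarrow> Q g \<in> L2 M"
  by (auto simp: is_adjoint_def)

lemma is_adjoint_nonneg:
  assumes adj: "is_adjoint M P Q"
    and P_nonneg: "\<And>f. f \<in> L2 M \<Longrightarrow> AE x in M. 0 \<le> f x \<Longrightarrow> AE x in M. 0 \<le> P f x"
    and f: "f \<in> L2 M" "AE x in M. 0 \<le> f x"
  shows "AE x in M. 0 \<le> Q f x"
proof -
  let ?h = "\<lambda>x. pos_part (- Q f x)"
  have h: "?h \<in> L2 M" by (intro L2_pos_part L2_uminus is_adjoint_L2[OF adj f(1)])
  have "0 \<le> L2_inner M f (P ?h)" by (intro L2_inner_nonneg f P_nonneg h) auto
  also have "\<dots> = L2_inner M (Q f) ?h" by (rule is_adjoint_inner[OF adj h f(1)])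
  also have "\<dots> = L2_inner M (\<lambda>x. - ?h x) ?h"
    unfolding L2_inner_def
    by (rule Bochner_Integration.integral_cong) (auto simp: pos_part_def max_def)
  finally have "L2_norm M ?h = 0"
    using L2_norm_nonneg[of M ?h] by (simp add: L2_inner_minus_left flip: L2_norm_power2)
  from L2_norm_eq_0_AE[OF h this] show ?thesis
    by eventually_elim (simp add: pos_part_def max_def split: if_splits)
qed

locale markov_L2_adjoint = markov_L2 +
  fixes Pstar :: "('a \<Rightarrow> real) \<Rightarrow> ('a \<Rightarrow> real)"
  assumes adjoint: "is_adjoint M P Pstar"
begin

lemma L2_inner_Pstar:
  "f \<in> L2 M \<Longrightarrow> g \<in> L2 M \<Longrightarrow> L2_inner M (Pstar g) f = L2_inner M g (P f)"
  by (simp add: is_adjoint_inner[OF adjoint])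

lemma Pstar_markov_L2: "markov_L2 M Pstar"
proof (rule markov_L2I)
  note Pstar_L2 [simp] = is_adjoint_L2[OF adjoint]
  fix f assume f [simp]: "f \<in> L2 M"
  show "Pstar f \<in> L2 M" by simp
  show "expectation (Pstar f) = expectation f"
    using L2_inner_Pstar[OF L2_const[of 1] f] by (simp add: L2_inner_const L2_inner_P_const)
  show "AE x in M. 0 \<le> Pstar f x" if "AE x in M. 0 \<le> f x"
    using is_adjoint_nonneg[OF adjoint P_nonneg f that] by blast
  fix g assume g [simp]: "g \<in> L2 M"
  show "AE x in M. Pstar f x = Pstar g x" if eq: "AE x in M. f x = g x"
  proof (rule L2_eqI_AE)
    show "L2_inner M (Pstar f) h = L2_inner M (Pstar g) h" if "h \<in> L2 M" for h
      unfolding L2_inner_Pstar[OF that f] L2_inner_Pstar[OF that g]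
      using that eq by (intro L2_inner_cong_AE) auto
  qed simp_all
  show "AE x in M. Pstar (\<lambda>y. a * f y + b * g y) x = a * Pstar f x + b * Pstar g x" for a b
    by (rule L2_eqI_AE) (simp_all add: L2_inner_Pstar L2_inner_bilinear)
next
  show "AE x in M. Pstar (\<lambda>_. 1) x = 1"
    by (rule L2_eqI_AE) (simp_all add: is_adjoint_L2[OF adjoint] L2_inner_Pstar
        L2_inner_commute[of M "\<lambda>_. 1"] L2_inner_const expectation_P)
qed

sublocale Pstar: markov_L2 M Pstar by (rule Pstar_markov_L2)

definition P_sym :: "('a \<Rightarrow> real) \<Rightarrow> ('a \<Rightarrow> real)" where
  "P_sym f = (\<lambda>x. (P f x + Pstar f x) / 2)"

sublocale P_sym: markov_L2 M P_sym
  using convex_combination_markov_L2[OF Pstar_markov_L2, of "1 / 2" "1 / 2"]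
  by (simp add: P_sym_def[abs_def] add_divide_distrib)

lemma is_adjoint_P_sym: "is_adjoint M P_sym P_sym"
proof -
  have "L2_inner M g (P_sym f) = L2_inner M (P_sym g) f" if "f \<in> L2 M" "g \<in> L2 M" for f g
    using that L2_inner_Pstar[of f g] L2_inner_Pstar[of g f]
    by (simp add: P_sym_def L2_inner_bilinear L2_inner_commute[of M _ f]
        L2_inner_commute[of M "Pstar f" g])
  then show ?thesis by (auto simp: is_adjoint_def L2_inner_def)
qed

end

section \<open>The Dirichlet form and almost invariant functions\<close>

definition (in prob_space) dirichlet_form :: "(('a \<Rightarrow> real) \<Rightarrow> 'a \<Rightarrow> real) \<Rightarrow> ('a \<Rightarrow> real) \<Rightarrow> real" where
  "dirichlet_form P f = expectation (\<lambda>x. f x * (f x - P f x))"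

context markov_L2
begin

abbreviation \<E> :: "('a \<Rightarrow> real) \<Rightarrow> real" where
  "\<E> \<equiv> dirichlet_form P"

lemma dirichlet_form_eq:
  assumes "f \<in> L2 M"
  shows "\<E> f = (L2_norm M f)\<^sup>2 - L2_inner M f (P f)"
  using L2_inner_diff_right[OF assms assms P_L2[OF assms]]
  by (simp add: dirichlet_form_def L2_norm_power2 L2_inner_def)

lemma dirichlet_form_nonneg: "f \<in> L2 M \<Longrightarrow> 0 \<le> \<E> f"
  using abs_L2_inner_P_le[of f] by (simp add: dirichlet_form_eq)

lemma L2_norm_P_diff_power2_le:
  assumes f: "f \<in> L2 M"
  shows "(L2_norm M (\<lambda>x. P f x - f x))\<^sup>2 \<le> 2 * \<E> f"
proof -
  have "(L2_norm M (P f))\<^sup>2 \<le> (L2_norm M f)\<^sup>2"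
    by (intro power_mono L2_norm_P_le f) simp
  then show ?thesis
    using f by (simp add: L2_norm_diff_power2 dirichlet_form_eq L2_inner_commute[of M "P f" f])
qed

lemma dirichlet_form_abs_le:
  assumes f: "f \<in> L2 M"
  shows "\<E> (\<lambda>x. \<bar>f x\<bar>) \<le> \<E> f"
proof -
  have "L2_inner M f (P f) \<le> L2_inner M (\<lambda>x. \<bar>f x\<bar>) (P (\<lambda>x. \<bar>f x\<bar>))"
  proof (rule L2_inner_mono)
    show "AE x in M. f x * P f x \<le> \<bar>f x\<bar> * P (\<lambda>x. \<bar>f x\<bar>) x"
      using P_abs[OF f]
    proof eventually_elim
      case (elim x)
      have "f x * P f x \<le> \<bar>f x\<bar> * \<bar>P f x\<bar>" by (metis abs_ge_self abs_mult)
      also have "\<dots> \<le> \<bar>f x\<bar> * P (\<lambda>x. \<bar>f x\<bar>) x" by (intro mult_left_mono elim) auto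
      finally show ?case .
    qed
  qed (simp_all add: f)
  then show ?thesis by (simp add: dirichlet_form_eq f)
qed

lemma dirichlet_form_affine:
  assumes "f \<in> L2 M"
  shows "\<E> (\<lambda>x. a * f x + c) = a\<^sup>2 * \<E> f"
proof -
  let ?g = "\<lambda>x. a * f x + c"
  have "(L2_norm M ?g)\<^sup>2 = a\<^sup>2 * (L2_norm M f)\<^sup>2 + 2 * (a * c * expectation f) + c\<^sup>2"
    using assms
    by (simp add: L2_norm_add_power2 L2_norm_cmult L2_inner_const power_mult_distrib)
  moreover have "L2_inner M ?g (P ?g)
      = a\<^sup>2 * L2_inner M f (P f) + 2 * (a * c * expectation f) + c\<^sup>2"
    using assms
    by (simp add: L2_inner_bilinear L2_inner_P_add L2_inner_P_cmult L2_inner_P_const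
        L2_inner_commute[of M "\<lambda>_. c"] L2_inner_const expectation_P L2_integrable prob_space
        power2_eq_square distrib_left)
  ultimately show ?thesis by (simp add: dirichlet_form_eq assms right_diff_distrib)
qed

lemma dirichlet_form_parallelogram:
  assumes "f \<in> L2 M" "g \<in> L2 M"
  shows "\<E> (\<lambda>x. f x + g x) + \<E> (\<lambda>x. f x - g x) = 2 * \<E> f + 2 * \<E> g"
  using assms
  by (simp add: dirichlet_form_eq L2_norm_power2 L2_inner_bilinear L2_inner_P_add L2_inner_P_diff)

lemma dirichlet_form_pos_part_le:
  assumes f: "f \<in> L2 M"
  shows "\<E> (\<lambda>x. pos_part (f x)) \<le> \<E> f"
proof -
  have "(\<lambda>x. pos_part (f x)) = (\<lambda>x. 1 / 2 * (f x + \<bar>f x\<bar>) + 0)"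
    by (auto simp: pos_part_def)
  then have "\<E> (\<lambda>x. pos_part (f x)) = \<E> (\<lambda>x. f x + \<bar>f x\<bar>) / 4"
    using dirichlet_form_affine[of "\<lambda>x. f x + \<bar>f x\<bar>" "1 / 2" 0] f by (simp add: power2_eq_square)
  also have "\<dots> \<le> (2 * \<E> f + 2 * \<E> (\<lambda>x. \<bar>f x\<bar>)) / 4"
    using dirichlet_form_parallelogram[OF f L2_abs[OF f]]
      dirichlet_form_nonneg[of "\<lambda>x. f x - \<bar>f x\<bar>"] f by simp
  also have "\<dots> \<le> \<E> f" using dirichlet_form_abs_le[OF f] by simp
  finally show ?thesis .
qed

lemma dirichlet_form_pos_part_diff_le:
  assumes f: "f \<in> L2 M"
  shows "\<E> (\<lambda>x. pos_part (f x - c)) \<le> \<E> f"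
  using dirichlet_form_pos_part_le[of "\<lambda>x. f x - c"] dirichlet_form_affine[OF f, of 1 "- c"] f
  by simp

lemma dirichlet_form_min_le:
  assumes f: "f \<in> L2 M"
  shows "\<E> (\<lambda>x. min (f x) c) \<le> \<E> f"
proof -
  let ?g = "\<lambda>x. -1 * f x + c"
  have "(\<lambda>x. min (f x) c) = (\<lambda>x. -1 * pos_part (?g x) + c)" by (auto simp: pos_part_def)
  then have "\<E> (\<lambda>x. min (f x) c) = \<E> (\<lambda>x. pos_part (?g x))"
    using dirichlet_form_affine[of "\<lambda>x. pos_part (?g x)" "-1" c] f by simp
  also have "\<dots> \<le> \<E> ?g" using f by (intro dirichlet_form_pos_part_le) simp
  also have "\<dots> = \<E> f" using dirichlet_form_affine[OF f, of "-1" c] by simp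
  finally show ?thesis .
qed

definition defect :: "('a \<Rightarrow> real) \<Rightarrow> real" where
  "defect f = expectation (\<lambda>x. \<bar>P f x - f x\<bar>)"

lemma defect_cong_AE:
  assumes "f \<in> L2 M" "g \<in> borel_measurable M" "AE x in M. \<bar>P f x - f x\<bar> = g x"
  shows "defect f = expectation g"
  unfolding defect_def
  by (rule integral_cong_AE[OF L2_measurable]) (use assms in auto)

lemma defect_const: "defect (\<lambda>_. c) = 0"
  using defect_cong_AE[OF L2_const[of c], of "\<lambda>_. 0"] P_const[of c] by simp

lemma defect_le_dirichlet_form:
  assumes f: "f \<in> L2 M"
  shows "defect f \<le> sqrt (2 * \<E> f)"
  using L1_norm_le_L2_norm[of "\<lambda>x. P f x - f x"] real_le_rsqrt[OF L2_norm_P_diff_power2_le[OF f]] f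
  by (simp add: defect_def)

lemma dirichlet_form_le_defect:
  assumes [measurable]: "f \<in> borel_measurable M" and bound: "\<And>x. \<bar>f x\<bar> \<le> K"
  shows "\<E> f \<le> K * defect f"
proof -
  have f: "f \<in> L2 M" by (rule L2_bounded[where K = K]) (auto simp: bound)
  have "expectation (\<lambda>x. f x * (f x - P f x)) \<le> expectation (\<lambda>x. K * \<bar>P f x - f x\<bar>)"
  proof (rule integral_mono)
    fix x
    have "f x * (f x - P f x) \<le> \<bar>f x\<bar> * \<bar>P f x - f x\<bar>"
      by (metis abs_ge_self abs_minus_commute abs_mult)
    also have "\<dots> \<le> K * \<bar>P f x - f x\<bar>" by (intro mult_right_mono bound) simp
    finally show "f x * (f x - P f x) \<le> K * \<bar>P f x - f x\<bar>" .
  qed (intro L2_mult_integrable L2_integrable L2_cmult L2_abs L2_diff P_L2 f)+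
  then show ?thesis by (simp add: dirichlet_form_def defect_def)
qed

lemma defect_lincomb_le:
  assumes f: "f \<in> L2 M" and g: "g \<in> L2 M"
  shows "defect (\<lambda>x. a * f x + b * g x) \<le> \<bar>a\<bar> * defect f + \<bar>b\<bar> * defect g"
proof -
  have "AE x in M. \<bar>P (\<lambda>x. a * f x + b * g x) x - (a * f x + b * g x)\<bar>
      \<le> \<bar>a\<bar> * \<bar>P f x - f x\<bar> + \<bar>b\<bar> * \<bar>P g x - g x\<bar>"
    using P_lincomb[OF f g, of a b]
  proof eventually_elim
    case (elim x)
    then have "P (\<lambda>x. a * f x + b * g x) x - (a * f x + b * g x)
        = a * (P f x - f x) + b * (P g x - g x)" by (simp add: algebra_simps)
    then show ?case using abs_triangle_ineq by (metis abs_mult)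
  qed
  then have "defect (\<lambda>x. a * f x + b * g x)
      \<le> expectation (\<lambda>x. \<bar>a\<bar> * \<bar>P f x - f x\<bar> + \<bar>b\<bar> * \<bar>P g x - g x\<bar>)"
    unfolding defect_def by (rule integral_mono_AE[rotated 2]) (simp_all add: L2_integrable f g)
  also have "\<dots> = \<bar>a\<bar> * defect f + \<bar>b\<bar> * defect g"
    by (simp add: defect_def L2_integrable f g)
  finally show ?thesis .
qed

text \<open>By Jensen \<open>P (f\<^sup>2) - (P f)\<^sup>2 \<ge> 0\<close>, and \<open>P (f\<^sup>2) - f\<^sup>2\<close> has mean zero; so the absolute value
  of the latter is controlled by \<open>(P f)\<^sup>2 - f\<^sup>2\<close>.\<close>

lemma defect_square_le:
  assumes [measurable]: "f \<in> borel_measurable M" and bound: "\<And>x. \<bar>f x\<bar> \<le> K"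
  shows "defect (\<lambda>x. (f x)\<^sup>2) \<le> 4 * K * defect f"
proof -
  have f [simp]: "f \<in> L2 M" by (rule L2_bounded[where K = K]) (auto simp: bound)
  have square_L2 [simp]: "(\<lambda>x. (f x)\<^sup>2) \<in> L2 M"
    by (rule L2_bounded[where K = "K\<^sup>2"]) (use power_mono[OF bound abs_ge_zero, of _ 2] in auto)
  have "AE x in M. \<bar>P (\<lambda>x. (f x)\<^sup>2) x - (f x)\<^sup>2\<bar>
      \<le> P (\<lambda>x. (f x)\<^sup>2) x - (f x)\<^sup>2 + 4 * K * \<bar>P f x - f x\<bar>"
    using P_Jensen_square[OF f square_L2] P_bounded[OF f AE_I2[OF bound]]
  proof eventually_elim
    case (elim x)
    have "\<bar>(P f x)\<^sup>2 - (f x)\<^sup>2\<bar> = \<bar>P f x + f x\<bar> * \<bar>P f x - f x\<bar>"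
      by (simp add: power2_eq_square algebra_simps flip: abs_mult)
    also have "\<dots> \<le> (2 * K) * \<bar>P f x - f x\<bar>"
      using elim bound[of x] by (intro mult_right_mono) auto
    finally show ?case using elim(1) by (auto simp: abs_if split: if_splits)
  qed
  then have "defect (\<lambda>x. (f x)\<^sup>2)
      \<le> expectation (\<lambda>x. P (\<lambda>x. (f x)\<^sup>2) x - (f x)\<^sup>2 + 4 * K * \<bar>P f x - f x\<bar>)"
    unfolding defect_def by (rule integral_mono_AE[rotated 2]) (simp_all add: L2_integrable)
  also have "\<dots> = 4 * K * defect f"
    by (simp add: L2_integrable expectation_P defect_def)
  finally show ?thesis .
qed

lemma defect_mult_le:
  assumes [measurable]: "f \<in> borel_measurable M" "g \<in> borel_measurable M"
    and bounds: "\<And>x. \<bar>f x\<bar> \<le> K" "\<And>x. \<bar>g x\<bar> \<le> K"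
  shows "defect (\<lambda>x. f x * g x) \<le> 4 * K * (defect f + defect g)"
proof -
  have f: "f \<in> L2 M" and g: "g \<in> L2 M"
    by (rule L2_bounded[where K = K]; auto simp: bounds)+
  have square_L2: "(\<lambda>x. (f x + s * g x)\<^sup>2) \<in> L2 M"
    and defect_square: "defect (\<lambda>x. (f x + s * g x)\<^sup>2) \<le> 8 * K * (defect f + defect g)"
    if s: "\<bar>s\<bar> = 1" for s
  proof -
    have bound: "\<bar>f x + s * g x\<bar> \<le> 2 * K" for x
      using abs_triangle_ineq[of "f x" "s * g x"] bounds[of x] s by (simp add: abs_mult)
    then show "(\<lambda>x. (f x + s * g x)\<^sup>2) \<in> L2 M"
      by (intro L2_bounded[where K = "(2 * K)\<^sup>2"])
        (use power_mono[OF bound abs_ge_zero, of _ 2] in auto)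
    have "0 \<le> K" using bounds(1)[of undefined] by simp
    then show "defect (\<lambda>x. (f x + s * g x)\<^sup>2) \<le> 8 * K * (defect f + defect g)"
      using defect_square_le[of "\<lambda>x. f x + s * g x" "2 * K"] bound s
        mult_left_mono[OF defect_lincomb_le[OF f g, of 1 s], of "8 * K"] by simp
  qed
  let ?p = "\<lambda>x. (f x + 1 * g x)\<^sup>2" and ?m = "\<lambda>x. (f x + (-1) * g x)\<^sup>2"
  have "(\<lambda>x. f x * g x) = (\<lambda>x. 1 / 4 * ?p x + - (1 / 4) * ?m x)"
    by (auto simp: power2_eq_square algebra_simps)
  then have "defect (\<lambda>x. f x * g x) \<le> 1 / 4 * defect ?p + 1 / 4 * defect ?m"
    using defect_lincomb_le[OF square_L2 square_L2, of 1 "-1" "1 / 4" "- (1 / 4)"] by simp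
  then show ?thesis using defect_square[of 1] defect_square[of "-1"] by simp
qed

end

definition unit_functions :: "'a measure \<Rightarrow> ('a \<Rightarrow> real) set" where
  "unit_functions M = {g \<in> borel_measurable M. \<forall>x. 0 \<le> g x \<and> g x \<le> 1}"

lemma unit_functionsD:
  assumes "g \<in> unit_functions M"
  shows "g \<in> borel_measurable M" "0 \<le> g x" "g x \<le> 1" "\<bar>g x\<bar> \<le> 1"
  using assms by (auto simp: unit_functions_def)

lemma unit_functions_mult:
  "f \<in> unit_functions M \<Longrightarrow> g \<in> unit_functions M \<Longrightarrow> (\<lambda>x. f x * g x) \<in> unit_functions M"
  by (auto simp: unit_functions_def intro: mult_le_one)

lemma unit_functions_power2:
  "g \<in> unit_functions M \<Longrightarrow> (\<lambda>x. (g x)\<^sup>2) \<in> unit_functions M"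
  using unit_functions_mult[of g M g] by (simp add: power2_eq_square)

lemma (in finite_measure) unit_functions_L2 [simp]: "g \<in> unit_functions M \<Longrightarrow> g \<in> L2 M"
  by (rule L2_bounded[where K = 1]) (auto simp: unit_functions_def)

context prob_space
begin

lemma L2_norm_unit_function_le:
  assumes "g \<in> unit_functions M"
  shows "L2_norm M g \<le> 1"
  using L2_norm_mono[of g M "\<lambda>_. 1"] unit_functionsD[OF assms] assms by simp

lemma expectation_unit_function:
  assumes "g \<in> unit_functions M"
  shows "0 \<le> expectation g" "expectation g \<le> 1"
proof -
  show "0 \<le> expectation g" by (simp add: unit_functionsD[OF assms])
  have "expectation g \<le> expectation (\<lambda>_. 1)"
    using assms by (intro integral_mono L2_integrable) (auto simp: unit_functionsD(3))
  then show "expectation g \<le> 1" by (simp add: prob_space)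
qed

lemma variance_unit_function_le:
  assumes "g \<in> unit_functions M"
  shows "variance g \<le> 1"
proof -
  have "(L2_norm M g)\<^sup>2 \<le> 1" by (intro power_le_one L2_norm_unit_function_le assms) simp
  then show ?thesis
    unfolding L2_variance_eq[OF unit_functions_L2[OF assms]]
    using zero_le_power2[of "expectation g"] by linarith
qed

end

lemma (in markov_L2_adjoint) dirichlet_form_P_sym:
  assumes "f \<in> L2 M"
  shows "dirichlet_form P_sym f = \<E> f"
  using assms L2_inner_Pstar[of f f]
  by (simp add: dirichlet_form_eq P_sym.dirichlet_form_eq P_sym_def L2_inner_bilinear
      L2_inner_commute[of M f "Pstar f"])

section \<open>Asymptotic independence\<close>

locale ergodic_markov_L2 = markov_L2_adjoint +
  assumes ergodic: "ergodic_op M P"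
begin

definition coboundaries :: "('a \<Rightarrow> real) set" where
  "coboundaries = {u \<in> L2 M. \<exists>h\<in>L2 M. AE x in M. u x = h x - Pstar h x}"

lemma coboundaries_L2: "u \<in> coboundaries \<Longrightarrow> u \<in> L2 M"
  by (simp add: coboundaries_def)

lemma coboundariesI: "h \<in> L2 M \<Longrightarrow> (\<lambda>x. h x - Pstar h x) \<in> coboundaries"
  by (auto simp: coboundaries_def)

lemma L2_subspace_coboundaries: "L2_subspace M coboundaries"
  unfolding L2_subspace_def
proof (intro conjI ballI allI)
  show "coboundaries \<subseteq> L2 M" using coboundaries_L2 by blast
  have "AE x in M. 0 = 0 - Pstar (\<lambda>_. 0) x" using Pstar.P_const[of 0] by simp
  then show "(\<lambda>_. 0) \<in> coboundaries" by (auto simp: coboundaries_def intro!: bexI[of _ "\<lambda>_. 0"])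
  fix u w a assume "u \<in> coboundaries" "w \<in> coboundaries"
  then obtain h k where in_L2: "u \<in> L2 M" "w \<in> L2 M" "h \<in> L2 M" "k \<in> L2 M"
    and eq: "AE x in M. u x = h x - Pstar h x" "AE x in M. w x = k x - Pstar k x"
    by (auto simp: coboundaries_def)
  have "AE x in M. u x + a * w x = (1 * h x + a * k x) - Pstar (\<lambda>x. 1 * h x + a * k x) x"
    using eq Pstar.P_lincomb[OF in_L2(3,4), of 1 a]
    by eventually_elim (simp add: right_diff_distrib)
  then show "(\<lambda>x. u x + a * w x) \<in> coboundaries"
    using in_L2 by (auto simp: coboundaries_def intro!: bexI[of _ "\<lambda>x. 1 * h x + a * k x"])
qed

lemma expectation_coboundary:
  assumes "u \<in> coboundaries"
  shows "expectation u = 0"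
proof -
  from assms obtain h where [simp]: "u \<in> L2 M" "h \<in> L2 M"
    and eq: "AE x in M. u x = h x - Pstar h x" by (auto simp: coboundaries_def)
  have "expectation u = expectation (\<lambda>x. h x - Pstar h x)"
    using eq by (intro integral_cong_AE L2_measurable) auto
  then show ?thesis by (simp add: L2_integrable Pstar.expectation_P)
qed

lemma orthogonal_coboundaries_imp_const:
  assumes v: "v \<in> L2 M" and orth: "\<And>u. u \<in> coboundaries \<Longrightarrow> L2_inner M v u = 0"
  obtains c where "AE x in M. v x = c"
proof -
  have "AE x in M. P v x = v x"
  proof (rule L2_eqI_AE[OF P_L2[OF v] v])
    fix h assume h: "h \<in> L2 M"
    then have "L2_inner M v h = L2_inner M v (Pstar h)"
      using orth[OF coboundariesI[OF h]] v by (simp add: L2_inner_diff_right)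
    then show "L2_inner M (P v) h = L2_inner M v h"
      using L2_inner_Pstar[OF v h] by (simp add: L2_inner_commute)
  qed
  then show ?thesis using ergodic v that by (auto simp: ergodic_op_def)
qed

lemma coboundaries_dense:
  assumes F: "F \<in> L2 M" and mean: "expectation F = 0" and "\<kappa> > 0"
  obtains h where "h \<in> L2 M" "L2_norm M (\<lambda>x. F x - (h x - Pstar h x)) < \<kappa>"
proof -
  obtain v where v: "v \<in> L2 M" and orth: "\<And>u. u \<in> coboundaries \<Longrightarrow> L2_inner M v u = 0"
    and close: "\<And>\<epsilon>. \<epsilon> > 0 \<Longrightarrow> \<exists>u\<in>coboundaries. L2_norm M (\<lambda>x. (F x - u x) - v x) < \<epsilon>"
    by (rule L2_orthogonal_residual[OF L2_subspace_coboundaries F]) blast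
  obtain c where c: "AE x in M. v x = c"
    by (rule orthogonal_coboundaries_imp_const[OF v orth])
  have "expectation v = c"
    using c L2_measurable[OF v]
    by (subst integral_cong_AE[where g = "\<lambda>_. c"]) (auto simp: prob_space)
  have mean_less: "\<bar>expectation v\<bar> < \<epsilon>" if "\<epsilon> > 0" for \<epsilon>
  proof -
    obtain u where u: "u \<in> coboundaries" "L2_norm M (\<lambda>x. (F x - u x) - v x) < \<epsilon>"
      using close[OF \<open>\<epsilon> > 0\<close>] by blast
    have "\<bar>expectation v\<bar> = \<bar>expectation (\<lambda>x. (F x - u x) - v x)\<bar>"
      using u(1) F v by (simp add: L2_integrable mean coboundaries_L2 expectation_coboundary)
    also have "\<dots> \<le> expectation (\<lambda>x. \<bar>(F x - u x) - v x\<bar>)" by (rule integral_abs_bound)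
    also have "\<dots> \<le> L2_norm M (\<lambda>x. (F x - u x) - v x)"
      using L1_norm_le_L2_norm[of "\<lambda>x. (F x - u x) - v x"] u(1) F v
      by (simp add: coboundaries_L2)
    finally show ?thesis using u(2) by simp
  qed
  have "expectation v = 0" using mean_less[of "\<bar>expectation v\<bar>"] by auto
  then have v_zero: "AE x in M. v x = 0" using c \<open>expectation v = c\<close> by simp
  obtain u where u: "u \<in> coboundaries" "L2_norm M (\<lambda>x. (F x - u x) - v x) < \<kappa>"
    using close[OF \<open>\<kappa> > 0\<close>] by blast
  then obtain h where h: "h \<in> L2 M" and eq: "AE x in M. u x = h x - Pstar h x"
    by (auto simp: coboundaries_def)
  have "L2_norm M (\<lambda>x. F x - (h x - Pstar h x)) = L2_norm M (\<lambda>x. (F x - u x) - v x)"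
    using eq v_zero coboundaries_L2[OF u(1)] F v h by (intro L2_norm_cong_AE) auto
  with u(2) h show ?thesis by (intro that) auto
qed

lemma covariance_le_coboundary_approximation:
  assumes F: "F \<in> L2 M" and h: "h \<in> L2 M" and g: "g \<in> L2 M"
  shows "\<bar>expectation (\<lambda>x. F x * g x) - expectation F * expectation g\<bar>
    \<le> L2_norm M (\<lambda>x. F x - expectation F - (h x - Pstar h x)) * L2_norm M g
      + L2_norm M h * L2_norm M (\<lambda>x. P g x - g x)"
proof -
  let ?w = "\<lambda>x. F x - expectation F - (h x - Pstar h x)"
  have "expectation (\<lambda>x. F x * g x) - expectation F * expectation g
      = L2_inner M ?w g - L2_inner M h (\<lambda>x. P g x - g x)"
    using assms L2_inner_Pstar[OF g h]
    by (simp add: L2_inner_bilinear L2_inner_commute[of M "\<lambda>_. expectation F"] L2_inner_const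
        L2_inner_def[of M F g])
  moreover have "\<bar>L2_inner M ?w g\<bar> \<le> L2_norm M ?w * L2_norm M g"
    using assms by (intro L2_Cauchy_Schwarz) simp_all
  moreover have "\<bar>L2_inner M h (\<lambda>x. P g x - g x)\<bar> \<le> L2_norm M h * L2_norm M (\<lambda>x. P g x - g x)"
    using assms by (intro L2_Cauchy_Schwarz) simp_all
  ultimately show ?thesis by linarith
qed

lemma asymptotic_independence:
  assumes F: "F \<in> L2 M" and "\<kappa> > 0"
  shows "\<exists>\<eta>>0. \<forall>g\<in>unit_functions M. defect g \<le> \<eta> \<longrightarrow>
    \<bar>expectation (\<lambda>x. F x * g x) - expectation F * expectation g\<bar> \<le> \<kappa>"
proof -
  have centered: "(\<lambda>x. F x - expectation F) \<in> L2 M" "expectation (\<lambda>x. F x - expectation F) = 0"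
    using F by (simp_all add: L2_integrable prob_space)
  obtain h where h: "h \<in> L2 M"
    and small: "L2_norm M (\<lambda>x. F x - expectation F - (h x - Pstar h x)) < \<kappa> / 2"
    using coboundaries_dense[OF centered, of "\<kappa> / 2"] \<open>\<kappa> > 0\<close> by auto
  define A where "A = L2_norm M h + 1"
  define \<alpha> where "\<alpha> = \<kappa> / (2 * A)"
  have A: "A > 0" "L2_norm M h \<le> A" by (simp_all add: A_def add_nonneg_pos)
  then have \<alpha>: "\<alpha> > 0" "A * \<alpha> = \<kappa> / 2" using \<open>\<kappa> > 0\<close> by (simp_all add: \<alpha>_def)
  have "\<bar>expectation (\<lambda>x. F x * g x) - expectation F * expectation g\<bar> \<le> \<kappa>"
    if g: "g \<in> unit_functions M" and defect: "defect g \<le> \<alpha>\<^sup>2 / 2" for g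
  proof -
    have "(L2_norm M (\<lambda>x. P g x - g x))\<^sup>2 \<le> \<alpha>\<^sup>2"
      using L2_norm_P_diff_power2_le[OF unit_functions_L2[OF g]] defect
        dirichlet_form_le_defect[OF unit_functionsD(1,4)[OF g]] by simp
    then have "L2_norm M (\<lambda>x. P g x - g x) \<le> \<alpha>"
      by (rule power2_le_imp_le) (use \<alpha>(1) in simp)
    then have "L2_norm M h * L2_norm M (\<lambda>x. P g x - g x) \<le> A * \<alpha>"
      using A by (intro mult_mono) simp_all
    moreover have "L2_norm M (\<lambda>x. F x - expectation F - (h x - Pstar h x)) * L2_norm M g
        \<le> \<kappa> / 2 * 1"
      using small \<open>\<kappa> > 0\<close> by (intro mult_mono L2_norm_unit_function_le g) simp_all
    ultimately show ?thesis
      using covariance_le_coboundary_approximation[OF F h unit_functions_L2[OF g]] \<alpha>(2) by simp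
  qed
  then show ?thesis using \<alpha>(1) by (intro exI[of _ "\<alpha>\<^sup>2 / 2"]) auto
qed

end

section \<open>Concentrating functions in the absence of a spectral gap\<close>

context prob_space
begin

definition poincare_inequality :: "(('a \<Rightarrow> real) \<Rightarrow> 'a \<Rightarrow> real) \<Rightarrow> real \<Rightarrow> bool" where
  "poincare_inequality P C \<longleftrightarrow> (\<forall>f\<in>L2 M. variance f \<le> C * dirichlet_form P f)"

definition spectral_gap :: "(('a \<Rightarrow> real) \<Rightarrow> 'a \<Rightarrow> real) \<Rightarrow> bool" where
  "spectral_gap P \<longleftrightarrow> (\<exists>C. poincare_inequality P C)"

definition concentrated :: "(('a \<Rightarrow> real) \<Rightarrow> 'a \<Rightarrow> real) \<Rightarrow> real \<Rightarrow> ('a \<Rightarrow> real) \<Rightarrow> bool" where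
  "concentrated P \<epsilon> f \<longleftrightarrow> f \<in> L2 M \<and> (\<forall>x. 0 \<le> f x) \<and> 0 < L2_norm M f \<and>
    dirichlet_form P f \<le> \<epsilon> * (L2_norm M f)\<^sup>2 \<and> (expectation f)\<^sup>2 \<le> \<epsilon> * (L2_norm M f)\<^sup>2"

definition concentrating :: "(('a \<Rightarrow> real) \<Rightarrow> 'a \<Rightarrow> real) \<Rightarrow> bool" where
  "concentrating P \<longleftrightarrow> (\<forall>\<epsilon>>0. \<exists>f\<in>L2 M. (\<forall>x. 0 \<le> f x) \<and> L2_norm M f = 1 \<and>
    dirichlet_form P f \<le> \<epsilon> \<and> expectation f \<le> \<epsilon>)"

end

text \<open>In the next lemma \<open>a, b, m\<close> are the means and \<open>A, B, s\<close> the squared norms of a function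
  \<open>G\<close>, a nearly independent factor \<open>g\<close> of variance at least \<open>v\<close>, and their product.\<close>

lemma product_concentration_arith:
  fixes a b A B s m c q v \<kappa> :: real
  assumes a: "0 \<le> a" "a \<le> 1" and b: "0 \<le> b" "b \<le> 1" and "0 \<le> m"
    and A: "c \<le> A" "A \<le> 1" and "B \<le> 1" and "0 < v" "0 < c" and q: "0 \<le> q" "q \<le> 1"
    and a_square_le: "a\<^sup>2 \<le> q * A" and variance_ge: "v \<le> B - b\<^sup>2" and \<kappa>_eq: "\<kappa> = q * c * v\<^sup>2 / 8"
    and m_close: "\<bar>m - a * b\<bar> \<le> \<kappa>" and s_close: "\<bar>s - A * B\<bar> \<le> \<kappa>"
  shows "c * v / 2 \<le> s" "m\<^sup>2 \<le> q * (1 - v / 2) * s"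
proof -
  have v: "v \<le> B" "v \<le> 1" using variance_ge zero_le_power2[of b] \<open>B \<le> 1\<close> by linarith+
  have product_norm: "c * v \<le> A * B" using A v \<open>0 < v\<close> \<open>0 < c\<close> by (intro mult_mono) auto
  have "q * (c * v * v) \<le> 1 * (c * v * 1)"
    using q v \<open>0 < v\<close> \<open>0 < c\<close> by (intro mult_mono mult_nonneg_nonneg) auto
  then have \<kappa>_le: "8 * \<kappa> \<le> c * v" by (simp add: \<kappa>_eq power2_eq_square mult.assoc)
  have "0 \<le> \<kappa>" using m_close by linarith
  then show "c * v / 2 \<le> s" using product_norm s_close \<kappa>_le by linarith
  have "c * v \<le> 1" using A v \<open>0 < v\<close> \<open>0 < c\<close> by (intro mult_le_one) auto
  then have "\<kappa> \<le> 1" using \<kappa>_le by linarith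
  have product_mean: "0 \<le> a * b" "a * b \<le> 1" using a b by (auto intro: mult_le_one)
  have "m\<^sup>2 \<le> (a * b + \<kappa>)\<^sup>2" using m_close \<open>0 \<le> m\<close> by (intro power_mono) auto
  also have "\<dots> = a\<^sup>2 * b\<^sup>2 + 2 * ((a * b) * \<kappa>) + \<kappa> * \<kappa>"
    by (simp add: power2_eq_square algebra_simps)
  also have "\<dots> \<le> (q * A) * (B * (1 - v)) + 2 * (1 * \<kappa>) + 1 * \<kappa>"
  proof -
    have "B * v \<le> 1 * v" using \<open>B \<le> 1\<close> \<open>0 < v\<close> by (intro mult_right_mono) auto
    then have "b\<^sup>2 \<le> B * (1 - v)" using variance_ge by (simp add: right_diff_distrib)
    then show ?thesis
      using product_mean a_square_le q A \<open>0 < c\<close> \<open>0 \<le> \<kappa>\<close> \<open>\<kappa> \<le> 1\<close>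
      by (intro add_mono mult_mono mult_left_mono) auto
  qed
  also have "\<dots> \<le> q * (1 - v / 2) * (A * B) - \<kappa>"
  proof -
    have "q * (c * v) * v \<le> q * (A * B) * v"
      using q \<open>0 < v\<close> by (intro mult_right_mono mult_left_mono product_norm) auto
    then show ?thesis by (simp add: \<kappa>_eq power2_eq_square algebra_simps)
  qed
  also have "\<dots> \<le> q * (1 - v / 2) * (A * B - \<kappa>)"
  proof -
    have "q * (1 - v / 2) * \<kappa> \<le> 1 * \<kappa>"
      using q v \<open>0 < v\<close> \<open>0 \<le> \<kappa>\<close> by (intro mult_right_mono mult_le_one) auto
    then show ?thesis by (simp add: right_diff_distrib)
  qed
  also have "\<dots> \<le> q * (1 - v / 2) * s"
    using s_close q v by (intro mult_left_mono) auto
  finally show "m\<^sup>2 \<le> q * (1 - v / 2) * s" .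
qed

context ergodic_markov_L2
begin

lemma product_with_independent_factor:
  assumes G: "G \<in> unit_functions M" and "0 < c" "c \<le> (L2_norm M G)\<^sup>2" and "0 < v"
    and q: "0 < q" "q \<le> 1" and mean_G: "(expectation G)\<^sup>2 \<le> q * (L2_norm M G)\<^sup>2"
  shows "\<exists>\<eta>>0. \<forall>g\<in>unit_functions M. v \<le> variance g \<longrightarrow> defect g \<le> \<eta> \<longrightarrow>
    c * v / 2 \<le> (L2_norm M (\<lambda>x. G x * g x))\<^sup>2 \<and>
    (expectation (\<lambda>x. G x * g x))\<^sup>2 \<le> q * (1 - v / 2) * (L2_norm M (\<lambda>x. G x * g x))\<^sup>2"
proof -
  define \<kappa> where "\<kappa> = q * c * v\<^sup>2 / 8"
  have "\<kappa> > 0" using assms by (simp add: \<kappa>_def)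
  obtain \<eta>\<^sub>1 where \<eta>\<^sub>1: "\<eta>\<^sub>1 > 0" and mean: "\<And>g. g \<in> unit_functions M \<Longrightarrow> defect g \<le> \<eta>\<^sub>1 \<Longrightarrow>
      \<bar>expectation (\<lambda>x. G x * g x) - expectation G * expectation g\<bar> \<le> \<kappa>"
    using asymptotic_independence[OF unit_functions_L2[OF G] \<open>\<kappa> > 0\<close>] by blast
  obtain \<eta>\<^sub>2 where \<eta>\<^sub>2: "\<eta>\<^sub>2 > 0" and square: "\<And>g. g \<in> unit_functions M \<Longrightarrow> defect g \<le> \<eta>\<^sub>2 \<Longrightarrow>
      \<bar>expectation (\<lambda>x. (G x)\<^sup>2 * g x) - expectation (\<lambda>x. (G x)\<^sup>2) * expectation g\<bar> \<le> \<kappa>"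
    using asymptotic_independence[OF unit_functions_L2[OF unit_functions_power2[OF G]] \<open>\<kappa> > 0\<close>]
    by blast
  have "c * v / 2 \<le> (L2_norm M (\<lambda>x. G x * g x))\<^sup>2 \<and>
      (expectation (\<lambda>x. G x * g x))\<^sup>2 \<le> q * (1 - v / 2) * (L2_norm M (\<lambda>x. G x * g x))\<^sup>2"
    if g: "g \<in> unit_functions M" and v: "v \<le> variance g" and defect: "defect g \<le> min \<eta>\<^sub>1 (\<eta>\<^sub>2 / 4)"
    for g
  proof -
    have "defect (\<lambda>x. (g x)\<^sup>2) \<le> \<eta>\<^sub>2"
      using defect_square_le[OF unit_functionsD(1,4)[OF g]] defect by simp
    then have "\<bar>expectation (\<lambda>x. (G x)\<^sup>2 * (g x)\<^sup>2)
        - expectation (\<lambda>x. (G x)\<^sup>2) * expectation (\<lambda>x. (g x)\<^sup>2)\<bar> \<le> \<kappa>"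
      by (rule square[OF unit_functions_power2[OF g]])
    then have norm_product:
        "\<bar>(L2_norm M (\<lambda>x. G x * g x))\<^sup>2 - (L2_norm M G)\<^sup>2 * (L2_norm M g)\<^sup>2\<bar> \<le> \<kappa>"
      by (simp add: L2_norm_power2 L2_inner_self power_mult_distrib)
    have mean_product: "\<bar>expectation (\<lambda>x. G x * g x) - expectation G * expectation g\<bar> \<le> \<kappa>"
      using mean[OF g] defect by simp
    have norm_le: "(L2_norm M h)\<^sup>2 \<le> 1" if "h \<in> unit_functions M" for h
      by (intro power_le_one L2_norm_unit_function_le that) simp
    have "v \<le> (L2_norm M g)\<^sup>2 - (expectation g)\<^sup>2"
      using v by (simp only: L2_variance_eq unit_functions_L2 g)
    then show ?thesis
      using product_concentration_arith[OF expectation_unit_function[OF G]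
          expectation_unit_function[OF g]
          expectation_unit_function(1)[OF unit_functions_mult[OF G g]]
          \<open>c \<le> _\<close> norm_le[OF G] norm_le[OF g] \<open>0 < v\<close> \<open>0 < c\<close> less_imp_le[OF q(1)] q(2) mean_G _
          \<kappa>_def mean_product norm_product]
      by blast
  qed
  then show ?thesis using \<eta>\<^sub>1 \<eta>\<^sub>2 by (intro exI[of _ "min \<eta>\<^sub>1 (\<eta>\<^sub>2 / 4)"]) auto
qed

lemma products_of_almost_invariant_factors:
  assumes v: "0 < v"
    and factors: "\<And>\<delta>. \<delta> > 0 \<Longrightarrow> \<exists>g\<in>unit_functions M. v \<le> variance g \<and> defect g \<le> \<delta>"
    and "\<delta> > 0"
  shows "\<exists>G\<in>unit_functions M. defect G \<le> \<delta> \<and> (v / 2) ^ k \<le> (L2_norm M G)\<^sup>2 \<and>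
    (expectation G)\<^sup>2 \<le> (1 - v / 2) ^ k * (L2_norm M G)\<^sup>2"
  using \<open>\<delta> > 0\<close>
proof (induction k arbitrary: \<delta>)
  case 0
  then show ?case
    by (intro bexI[of _ "\<lambda>_. 1"]) (auto simp: defect_const unit_functions_def prob_space)
next
  case (Suc k)
  obtain g\<^sub>1 where "g\<^sub>1 \<in> unit_functions M" "v \<le> variance g\<^sub>1" using factors[of 1] by auto
  then have "v \<le> 1" using variance_unit_function_le order_trans by blast
  then have q: "0 < (1 - v / 2) ^ k" "(1 - v / 2) ^ k \<le> 1" using v by (auto intro: power_le_one)
  have c: "0 < (v / 2) ^ k" using v by simp
  obtain G where G: "G \<in> unit_functions M" and G_defect: "defect G \<le> \<delta> / 8"
    and G_norm: "(v / 2) ^ k \<le> (L2_norm M G)\<^sup>2"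
    and G_mean: "(expectation G)\<^sup>2 \<le> (1 - v / 2) ^ k * (L2_norm M G)\<^sup>2"
    using Suc.IH[of "\<delta> / 8"] Suc.prems by auto
  obtain \<eta> where "\<eta> > 0" and independent: "\<And>g. g \<in> unit_functions M \<Longrightarrow> v \<le> variance g \<Longrightarrow>
      defect g \<le> \<eta> \<Longrightarrow> (v / 2) ^ k * v / 2 \<le> (L2_norm M (\<lambda>x. G x * g x))\<^sup>2 \<and>
      (expectation (\<lambda>x. G x * g x))\<^sup>2
        \<le> (1 - v / 2) ^ k * (1 - v / 2) * (L2_norm M (\<lambda>x. G x * g x))\<^sup>2"
    using product_with_independent_factor[OF G c G_norm v q G_mean] by blast
  obtain g where g: "g \<in> unit_functions M" "v \<le> variance g" "defect g \<le> min \<eta> (\<delta> / 8)"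
    using factors[of "min \<eta> (\<delta> / 8)"] \<open>\<eta> > 0\<close> Suc.prems by auto
  have "defect (\<lambda>x. G x * g x) \<le> \<delta>"
    using defect_mult_le[OF unit_functionsD(1)[OF G] unit_functionsD(1)[OF g(1)]
        unit_functionsD(4)[OF G] unit_functionsD(4)[OF g(1)]] G_defect g(3) by simp
  then show ?case
    using independent[OF g(1,2)] g(3) unit_functions_mult[OF G g(1)]
    by (intro bexI[of _ "\<lambda>x. G x * g x"]) (auto simp: mult_ac)
qed

lemma almost_invariant_factors_concentrate:
  assumes v: "0 < v"
    and factors: "\<And>\<delta>. \<delta> > 0 \<Longrightarrow> \<exists>g\<in>unit_functions M. v \<le> variance g \<and> defect g \<le> \<delta>"
    and "\<epsilon> > 0"
  shows "\<exists>G. concentrated P \<epsilon> G"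
proof -
  obtain k where k: "(1 - v / 2) ^ k \<le> \<epsilon>"
  proof (cases "1 - v / 2 \<ge> 0")
    case True
    then show ?thesis
      using real_arch_pow_inv[OF \<open>\<epsilon> > 0\<close>, of "1 - v / 2"] v that by (auto dest: less_imp_le)
  next
    case False
    then show ?thesis using that[of 1] \<open>\<epsilon> > 0\<close> by simp
  qed
  have "\<epsilon> * (v / 2) ^ k > 0" using \<open>\<epsilon> > 0\<close> v by simp
  from products_of_almost_invariant_factors[OF v factors this]
  obtain G where G: "G \<in> unit_functions M" and defect: "defect G \<le> \<epsilon> * (v / 2) ^ k"
    and norm: "(v / 2) ^ k \<le> (L2_norm M G)\<^sup>2"
    and mean: "(expectation G)\<^sup>2 \<le> (1 - v / 2) ^ k * (L2_norm M G)\<^sup>2" by blast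
  have "\<E> G \<le> defect G"
    using dirichlet_form_le_defect[OF unit_functionsD(1,4)[OF G]] by simp
  also have "\<dots> \<le> \<epsilon> * (L2_norm M G)\<^sup>2"
    using defect mult_left_mono[OF norm less_imp_le[OF \<open>\<epsilon> > 0\<close>]] by linarith
  finally have "\<E> G \<le> \<epsilon> * (L2_norm M G)\<^sup>2" .
  moreover have "(expectation G)\<^sup>2 \<le> \<epsilon> * (L2_norm M G)\<^sup>2"
    using mean mult_right_mono[OF k zero_le_power2[of "L2_norm M G"]] by simp
  moreover have "0 < (L2_norm M G)\<^sup>2"
    by (rule less_le_trans[OF _ norm]) (use v in simp)
  then have "0 < L2_norm M G" by (simp add: less_le)
  ultimately have "concentrated P \<epsilon> G"
    using G unit_functionsD(2)[OF G] by (simp add: concentrated_def)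
  then show ?thesis by blast
qed

end

context markov_L2
begin

lemma concentratingI:
  assumes "\<And>\<epsilon>. \<epsilon> > 0 \<Longrightarrow> \<exists>f. concentrated P \<epsilon> f"
  shows "concentrating P"
  unfolding concentrating_def
proof (intro allI impI)
  fix \<epsilon> :: real assume "\<epsilon> > 0"
  define \<delta> where "\<delta> = min \<epsilon> (\<epsilon>\<^sup>2)"
  have \<delta>: "\<delta> > 0" "\<delta> \<le> \<epsilon>" "\<delta> \<le> \<epsilon>\<^sup>2" using \<open>\<epsilon> > 0\<close> by (auto simp: \<delta>_def)
  from assms[OF \<delta>(1)] obtain f where f: "f \<in> L2 M" and nonneg: "\<forall>x. 0 \<le> f x"
    and "0 < L2_norm M f" and form: "\<E> f \<le> \<delta> * (L2_norm M f)\<^sup>2"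
    and mean: "(expectation f)\<^sup>2 \<le> \<delta> * (L2_norm M f)\<^sup>2" by (auto simp: concentrated_def)
  define n where "n = L2_norm M f"
  have n: "0 < n" using \<open>0 < L2_norm M f\<close> by (simp add: n_def)
  let ?h = "\<lambda>x. 1 / n * f x"
  have "L2_norm M ?h = 1" unfolding L2_norm_cmult using n by (simp flip: n_def)
  moreover have "\<E> f \<le> \<epsilon> * n\<^sup>2"
    using form mult_right_mono[OF \<delta>(2) zero_le_power2[of n]] by (simp add: n_def)
  then have "\<E> ?h \<le> \<epsilon>"
    using dirichlet_form_affine[OF f, of "1 / n" 0] n by (simp add: power_divide divide_le_eq)
  moreover have "(expectation f)\<^sup>2 \<le> (\<epsilon> * n)\<^sup>2"
    using mean mult_right_mono[OF \<delta>(3) zero_le_power2[of n]] by (simp add: n_def power_mult_distrib)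
  then have "expectation f \<le> \<epsilon> * n"
    by (rule power2_le_imp_le) (use n \<open>\<epsilon> > 0\<close> in simp)
  then have "expectation ?h \<le> \<epsilon>" using n by (simp add: divide_le_eq)
  ultimately show "\<exists>f\<in>L2 M. (\<forall>x. 0 \<le> f x) \<and> L2_norm M f = 1 \<and> \<E> f \<le> \<epsilon> \<and> expectation f \<le> \<epsilon>"
    using f nonneg n by (intro bexI[of _ ?h]) auto
qed

lemma no_spectral_gap_imp_normalized:
  assumes "\<not> spectral_gap P" "\<eta> > 0"
  obtains f where "f \<in> L2 M" "expectation f = 0" "L2_norm M f = 1" "\<E> f \<le> \<eta>"
proof -
  obtain f where f: "f \<in> L2 M" and "1 / \<eta> * \<E> f < variance f"
    using \<open>\<not> spectral_gap P\<close> unfolding spectral_gap_def poincare_inequality_def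
    by (meson not_le)
  then have less: "\<E> f < \<eta> * variance f" using \<open>\<eta> > 0\<close> by (simp add: field_simps)
  define n where "n = sqrt (variance f)"
  have "0 < \<eta> * variance f" using less dirichlet_form_nonneg[OF f] by linarith
  then have n: "n > 0" "n\<^sup>2 = variance f" using \<open>\<eta> > 0\<close> by (simp_all add: n_def zero_less_mult_iff)
  let ?h = "\<lambda>x. 1 / n * f x + - (expectation f / n)"
  have h_eq: "?h = (\<lambda>x. 1 / n * (f x - expectation f))" by (auto simp: diff_divide_distrib)
  show ?thesis
  proof (rule that)
    show "?h \<in> L2 M" using f by simp
    show "expectation ?h = 0" using f by (simp add: L2_integrable prob_space)
    have "L2_norm M ?h = \<bar>1 / n\<bar> * n"
      unfolding h_eq L2_norm_cmult by (simp only: n_def sqrt_variance_eq)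
    then show "L2_norm M ?h = 1" using n(1) by simp
    show "\<E> ?h \<le> \<eta>"
      unfolding dirichlet_form_affine[OF f] using less n(1) unfolding n(2)[symmetric]
      by (simp add: power_divide pos_divide_le_eq)
  qed
qed

lemma large_excess_concentrates:
  assumes f: "f \<in> L2 M" "L2_norm M f = 1" and "\<epsilon> > 0" and form: "\<E> f \<le> \<epsilon> / 16"
    and excess: "1 / 4 \<le> L2_norm M (\<lambda>x. pos_part (\<bar>f x\<bar> - 4 / sqrt \<epsilon>))"
  shows "concentrated P \<epsilon> (\<lambda>x. pos_part (\<bar>f x\<bar> - 4 / sqrt \<epsilon>))"
proof -
  let ?u = "\<lambda>x. pos_part (\<bar>f x\<bar> - 4 / sqrt \<epsilon>)"
  have u: "?u \<in> L2 M" using f by simp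
  have "(1 / 4)\<^sup>2 \<le> (L2_norm M ?u)\<^sup>2" using excess by (intro power_mono) auto
  then have norm: "\<epsilon> / 16 \<le> \<epsilon> * (L2_norm M ?u)\<^sup>2"
    using mult_left_mono[of "(1 / 4)\<^sup>2" "(L2_norm M ?u)\<^sup>2" \<epsilon>] \<open>\<epsilon> > 0\<close> by (simp add: power_divide)
  have "\<E> ?u \<le> \<epsilon> / 16"
    using dirichlet_form_pos_part_diff_le[OF L2_abs[OF f(1)], of "4 / sqrt \<epsilon>"]
      dirichlet_form_abs_le[OF f(1)] form by linarith
  moreover have "expectation ?u \<le> sqrt \<epsilon> / 4"
    using integral_pos_part_diff_le[OF L2_abs[OF f(1)], of "4 / sqrt \<epsilon>"] f \<open>\<epsilon> > 0\<close> by simp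
  then have "(expectation ?u)\<^sup>2 \<le> (sqrt \<epsilon> / 4)\<^sup>2" by (rule power_mono) simp
  then have "(expectation ?u)\<^sup>2 \<le> \<epsilon> / 16" using \<open>\<epsilon> > 0\<close> by (simp add: power_divide)
  ultimately show ?thesis using norm excess u by (simp add: concentrated_def)
qed

lemma abs_affine_diff_clamp:
  fixes a K t :: real
  assumes "0 < a" "a * K = 1 / 2"
  shows "\<bar>a * t + 1 / 2 - pos_part (min (a * t + 1 / 2) 1)\<bar> = a * pos_part (\<bar>t\<bar> - K)"
proof -
  have "a * pos_part (\<bar>t\<bar> - K) = pos_part (\<bar>a * t\<bar> - 1 / 2)"
    using assms(1) pos_part_cmult[of a "\<bar>t\<bar> - K"]
    by (simp add: assms(2) abs_mult right_diff_distrib)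
  then show ?thesis by (auto simp: pos_part_def)
qed

lemma small_excess_imp_unit_function:
  assumes f: "f \<in> L2 M" "expectation f = 0" "L2_norm M f = 1" and "K > 0"
    and excess: "L2_norm M (\<lambda>x. pos_part (\<bar>f x\<bar> - K)) \<le> 1 / 4"
  obtains g where "g \<in> unit_functions M" "9 / (64 * K\<^sup>2) \<le> variance g" "\<E> g \<le> \<E> f / (4 * K\<^sup>2)"
proof
  define a where "a = 1 / (2 * K)"
  have a: "a > 0" "a * K = 1 / 2" "a\<^sup>2 = 1 / (4 * K\<^sup>2)"
    using \<open>K > 0\<close> by (simp_all add: a_def power_divide power_mult_distrib)
  let ?h = "\<lambda>x. a * f x + 1 / 2"
  let ?g = "\<lambda>x. pos_part (min (?h x) 1)"
  have h: "?h \<in> L2 M" using f by simp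
  have [measurable]: "f \<in> borel_measurable M" using f(1) by (rule L2_measurable)
  show g: "?g \<in> unit_functions M" by (auto simp: unit_functions_def pos_part_def)
  have min_h: "(\<lambda>x. min (?h x) 1) \<in> L2 M"
    by (rule L2_dominated[of "\<lambda>x. \<bar>?h x\<bar> + 1"]) (use h in auto)
  have "\<E> ?g \<le> \<E> ?h"
    using dirichlet_form_pos_part_le[OF min_h] dirichlet_form_min_le[OF h, of 1] by linarith
  then show "\<E> ?g \<le> \<E> f / (4 * K\<^sup>2)" by (simp add: dirichlet_form_affine f(1) a(3))
  have mean_h: "expectation ?h = 1 / 2" using f by (simp add: L2_integrable prob_space)
  have "L2_norm M (\<lambda>x. ?h x - 1 / 2) = a" using a(1) f(3) by (simp add: L2_norm_cmult)
  then have "sqrt (variance ?h) = a" by (subst sqrt_variance_eq) (simp only: mean_h)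
  moreover have "L2_norm M (\<lambda>x. ?h x - ?g x) \<le> a / 4"
  proof -
    have "L2_norm M (\<lambda>x. \<bar>?h x - ?g x\<bar>) = a * L2_norm M (\<lambda>x. pos_part (\<bar>f x\<bar> - K))"
      using a(1) by (simp only: abs_affine_diff_clamp[OF a(1,2)] L2_norm_cmult abs_of_pos)
    then show ?thesis using mult_left_mono[OF excess, of a] a(1) by simp
  qed
  ultimately have "3 / 4 * a \<le> sqrt (variance ?g)"
    using sqrt_variance_triangle[OF h unit_functions_L2[OF g]] by simp
  then have "(3 / 4 * a)\<^sup>2 \<le> (sqrt (variance ?g))\<^sup>2" using a(1) by (intro power_mono) auto
  then show "9 / (64 * K\<^sup>2) \<le> variance ?g" by (simp add: power_mult_distrib power_divide a(3))
qed

end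

theorem (in ergodic_markov_L2) no_spectral_gap_imp_concentrating:
  assumes "\<not> spectral_gap P"
  shows "concentrating P"
proof (rule concentratingI)
  fix \<epsilon> :: real assume "\<epsilon> > 0"
  define K where "K = 4 / sqrt \<epsilon>"
  have "K > 0" using \<open>\<epsilon> > 0\<close> by (simp add: K_def)
  show "\<exists>f. concentrated P \<epsilon> f"
  proof (cases "\<exists>f\<in>L2 M. L2_norm M f = 1 \<and> \<E> f \<le> \<epsilon> / 16 \<and>
      1 / 4 \<le> L2_norm M (\<lambda>x. pos_part (\<bar>f x\<bar> - K))")
    case True
    then show ?thesis using large_excess_concentrates[OF _ _ \<open>\<epsilon> > 0\<close>] unfolding K_def by blast
  next
    case False
    have "\<exists>g\<in>unit_functions M. 9 / (64 * K\<^sup>2) \<le> variance g \<and> defect g \<le> \<delta>" if "\<delta> > 0" for \<delta>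
    proof -
      have "min (\<epsilon> / 16) (2 * K\<^sup>2 * \<delta>\<^sup>2) > 0" using \<open>\<epsilon> > 0\<close> \<open>\<delta> > 0\<close> \<open>K > 0\<close> by simp
      then obtain f where f: "f \<in> L2 M" "expectation f = 0" "L2_norm M f = 1"
        and form: "\<E> f \<le> min (\<epsilon> / 16) (2 * K\<^sup>2 * \<delta>\<^sup>2)"
        by (rule no_spectral_gap_imp_normalized[OF assms])
      have "L2_norm M (\<lambda>x. pos_part (\<bar>f x\<bar> - K)) \<le> 1 / 4" using False f form by force
      then obtain g where g: "g \<in> unit_functions M" "9 / (64 * K\<^sup>2) \<le> variance g"
        and "\<E> g \<le> \<E> f / (4 * K\<^sup>2)"
        by (rule small_excess_imp_unit_function[OF f \<open>K > 0\<close>])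
      note this(3)
      also have "\<dots> \<le> 2 * K\<^sup>2 * \<delta>\<^sup>2 / (4 * K\<^sup>2)" using form by (intro divide_right_mono) auto
      finally have "2 * \<E> g \<le> \<delta>\<^sup>2" using \<open>K > 0\<close> by simp
      then have "defect g \<le> \<delta>"
        using defect_le_dirichlet_form[OF unit_functions_L2[OF g(1)]] real_le_lsqrt[of \<delta> "2 * \<E> g"]
          \<open>\<delta> > 0\<close> by simp
      then show ?thesis using g by blast
    qed
    then show ?thesis
      using almost_invariant_factors_concentrate[of "9 / (64 * K\<^sup>2)"] \<open>K > 0\<close> \<open>\<epsilon> > 0\<close> by simp
  qed
qed

section \<open>Tail norms\<close>

lemma Lim_at_top_eq_INF:
  fixes T :: "real \<Rightarrow> real"
  assumes antimono: "\<And>R S. a \<le> R \<Longrightarrow> R \<le> S \<Longrightarrow> T S \<le> T R" and bdd: "bdd_below (T ` {a..})"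
  shows "Lim at_top T = (INF R\<in>{a..}. T R)"
proof (rule tendsto_Lim)
  show "(T \<longlongrightarrow> (INF R\<in>{a..}. T R)) at_top"
  proof (rule decreasing_tendsto)
    show "eventually (\<lambda>R. (INF R\<in>{a..}. T R) \<le> T R) at_top"
      using eventually_ge_at_top[of a] by eventually_elim (simp add: cINF_lower[OF bdd])
    fix x assume "(INF R\<in>{a..}. T R) < x"
    then obtain R where R: "a \<le> R" "T R < x" using bdd by (auto simp: cINF_less_iff)
    show "eventually (\<lambda>R. T R < x) at_top"
      using eventually_ge_at_top[of R] by eventually_elim (use antimono R in force)
  qed
qed simp

locale cutoff_family =
  fixes V :: "real \<Rightarrow> 'b \<Rightarrow> real" and B :: "'b set"
  assumes le_1: "0 \<le> R \<Longrightarrow> f \<in> B \<Longrightarrow> V R f \<le> 1"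
    and ex_nonneg: "0 \<le> R \<Longrightarrow> \<exists>f\<in>B. 0 \<le> V R f"
    and dominated: "0 \<le> R \<Longrightarrow> R \<le> S \<Longrightarrow> f \<in> B \<Longrightarrow> \<exists>g\<in>B. V S f \<le> V R g"
begin

lemma nonempty: "B \<noteq> {}"
  using ex_nonneg[of 0] by auto

lemma bdd_above_image: "0 \<le> R \<Longrightarrow> bdd_above (V R ` B)"
  by (rule bdd_aboveI[of _ 1]) (auto simp: le_1)

lemma SUP_nonneg: "0 \<le> R \<Longrightarrow> 0 \<le> (SUP f\<in>B. V R f)"
  using ex_nonneg[of R] by (auto intro: cSUP_upper2[OF bdd_above_image])

lemma bdd_below_SUP: "bdd_below ((\<lambda>R. SUP f\<in>B. V R f) ` {0..})"
  by (rule bdd_belowI[of _ 0]) (auto simp: SUP_nonneg)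

lemma Lim_Sup_eq: "Lim at_top (\<lambda>R. Sup {V R f | f. f \<in> B}) = (INF R\<in>{0..}. SUP f\<in>B. V R f)"
  unfolding Setcompr_eq_image
proof (rule Lim_at_top_eq_INF[OF _ bdd_below_SUP])
  fix R S :: real assume RS: "0 \<le> R" "R \<le> S"
  show "(SUP f\<in>B. V S f) \<le> (SUP f\<in>B. V R f)"
    by (rule cSUP_mono[OF nonempty bdd_above_image[OF RS(1)]]) (use dominated[OF RS] in blast)
qed

lemma Lim_Sup_le:
  assumes "0 \<le> R" "\<And>f. f \<in> B \<Longrightarrow> V R f \<le> b"
  shows "Lim at_top (\<lambda>R. Sup {V R f | f. f \<in> B}) \<le> b"
  unfolding Lim_Sup_eq
proof (rule cINF_lower2[OF bdd_below_SUP])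
  show "R \<in> {0..}" using assms(1) by simp
  show "(SUP f\<in>B. V R f) \<le> b" by (rule cSUP_least[OF nonempty assms(2)])
qed

lemma Lim_Sup_ge:
  assumes "\<And>R e. 0 \<le> R \<Longrightarrow> 0 < e \<Longrightarrow> \<exists>f\<in>B. b - e \<le> V R f"
  shows "b \<le> Lim at_top (\<lambda>R. Sup {V R f | f. f \<in> B})"
  unfolding Lim_Sup_eq
proof (rule cINF_greatest)
  fix R :: real assume "R \<in> {0..}"
  then have R: "0 \<le> R" by simp
  show "b \<le> (SUP f\<in>B. V R f)"
  proof (rule field_le_epsilon)
    fix e :: real assume "0 < e"
    then obtain f where "f \<in> B" "b - e \<le> V R f" using assms[OF R] by blast
    then show "b \<le> (SUP f\<in>B. V R f) + e"
      using cSUP_upper[OF _ bdd_above_image[OF R], of f] by linarith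
  qed
qed simp

lemma Lim_Sup_nonneg: "0 \<le> Lim at_top (\<lambda>R. Sup {V R f | f. f \<in> B})"
proof (rule Lim_Sup_ge)
  fix R e :: real assume "0 \<le> R" "0 < e"
  then show "\<exists>f\<in>B. 0 - e \<le> V R f" using ex_nonneg[of R] by force
qed

end

definition L2_ball :: "'a measure \<Rightarrow> ('a \<Rightarrow> real) set" where
  "L2_ball M = {f \<in> L2 M. L2_norm M f \<le> 1}"

lemma L2_ball_iff: "f \<in> L2_ball M \<longleftrightarrow> f \<in> L2 M \<and> integral\<^sup>L M (\<lambda>x. (f x)\<^sup>2) \<le> 1"
  by (simp add: L2_ball_def L2_norm_def L2_inner_self)

lemma L2_ballD: "f \<in> L2_ball M \<Longrightarrow> f \<in> L2 M" "f \<in> L2_ball M \<Longrightarrow> L2_norm M f \<le> 1"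
  by (simp_all add: L2_ball_def)

lemma L2_ball_abs: "f \<in> L2_ball M \<Longrightarrow> (\<lambda>x. \<bar>f x\<bar>) \<in> L2_ball M"
  by (simp add: L2_ball_def)

lemma L2_ball_pos_part:
  assumes "f \<in> L2_ball M"
  shows "(\<lambda>x. pos_part (f x)) \<in> L2_ball M"
  using assms L2_norm_mono[of "\<lambda>x. pos_part (f x)" M f] pos_part_diff_le_abs[of 0]
  by (simp add: L2_ball_def)

lemma (in finite_measure) L2_norm_pos_part_diff_le:
  assumes "f \<in> L2 M" "0 \<le> R"
  shows "L2_norm M (\<lambda>x. pos_part (f x - R)) \<le> L2_norm M f"
  by (rule L2_norm_mono) (use assms in \<open>auto simp: pos_part_diff_le_abs\<close>)

context markov_L2
begin

lemma L2_norm_P_ball: "f \<in> L2_ball M \<Longrightarrow> L2_norm M (P f) \<le> 1"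
  using L2_norm_P_le[of f] L2_ballD[of f M] by linarith

lemma tau_norm_eq: "tau_norm M P
    = Lim at_top (\<lambda>R. Sup {L2_inner M f (\<lambda>x. pos_part (P f x - R)) | f. f \<in> L2_ball M})"
  by (simp only: tau_norm_def L2_inner_def L2_ball_iff)

lemma tail_norm_eq: "tail_norm M P
    = Lim at_top (\<lambda>R. Sup {L2_norm M (\<lambda>x. pos_part (\<bar>P f x\<bar> - R)) | f. f \<in> L2_ball M})"
  by (simp only: tail_norm_def L2_norm_def L2_inner_self L2_ball_iff)

lemma L2_inner_cutoff_le_pos_part:
  assumes f: "f \<in> L2 M" and "R \<le> S"
  shows "L2_inner M f (\<lambda>x. pos_part (P f x - S))
    \<le> L2_inner M (\<lambda>x. pos_part (f x)) (\<lambda>x. pos_part (P (\<lambda>x. pos_part (f x)) x - R))"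
proof (rule L2_inner_mono)
  let ?g = "\<lambda>x. pos_part (f x)"
  have "AE x in M. P f x \<le> P ?g x" by (intro P_mono) (auto simp: f)
  then show "AE x in M. f x * pos_part (P f x - S) \<le> ?g x * pos_part (P ?g x - R)"
  proof eventually_elim
    case (elim x)
    have "f x * pos_part (P f x - S) \<le> ?g x * pos_part (P f x - S)"
      by (intro mult_right_mono) simp_all
    also have "\<dots> \<le> ?g x * pos_part (P ?g x - R)"
      using elim \<open>R \<le> S\<close> by (intro mult_left_mono pos_part_mono) auto
    finally show ?case .
  qed
qed (simp_all add: f)

lemma cutoff_family_tau:
  "cutoff_family (\<lambda>R f. L2_inner M f (\<lambda>x. pos_part (P f x - R))) (L2_ball M)"
proof
  fix R S :: real and f assume "0 \<le> R" and f: "f \<in> L2_ball M"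
  have "L2_inner M f (\<lambda>x. pos_part (P f x - R))
      \<le> L2_norm M f * L2_norm M (\<lambda>x. pos_part (P f x - R))"
    using L2_Cauchy_Schwarz[of f M "\<lambda>x. pos_part (P f x - R)"] L2_ballD(1)[OF f] by simp
  also have "\<dots> \<le> 1 * 1"
    using L2_norm_pos_part_diff_le[of "P f" R] L2_norm_P_ball[OF f] L2_ballD[OF f] \<open>0 \<le> R\<close>
    by (intro mult_mono) auto
  finally show "L2_inner M f (\<lambda>x. pos_part (P f x - R)) \<le> 1" by simp
  show "\<exists>g\<in>L2_ball M. L2_inner M f (\<lambda>x. pos_part (P f x - S))
      \<le> L2_inner M g (\<lambda>x. pos_part (P g x - R))" if "R \<le> S"
    using L2_inner_cutoff_le_pos_part[OF L2_ballD(1)[OF f] that] L2_ball_pos_part[OF f] by blast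
next
  fix R :: real
  show "\<exists>f\<in>L2_ball M. 0 \<le> L2_inner M f (\<lambda>x. pos_part (P f x - R))"
    by (rule bexI[of _ "\<lambda>_. 0"]) (auto simp: L2_ball_def L2_inner_def)
qed

lemma L2_norm_cutoff_le_abs:
  assumes f: "f \<in> L2 M" and "R \<le> S"
  shows "L2_norm M (\<lambda>x. pos_part (\<bar>P f x\<bar> - S)) \<le> L2_norm M (\<lambda>x. pos_part (\<bar>P (\<lambda>x. \<bar>f x\<bar>) x\<bar> - R))"
proof (rule L2_norm_mono)
  show "AE x in M. \<bar>pos_part (\<bar>P f x\<bar> - S)\<bar> \<le> \<bar>pos_part (\<bar>P (\<lambda>x. \<bar>f x\<bar>) x\<bar> - R)\<bar>"
    using P_abs[OF f] by eventually_elim (use \<open>R \<le> S\<close> in \<open>auto simp: pos_part_def\<close>)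
qed (simp_all add: f)

lemma cutoff_family_tail:
  "cutoff_family (\<lambda>R f. L2_norm M (\<lambda>x. pos_part (\<bar>P f x\<bar> - R))) (L2_ball M)"
proof
  fix R S :: real and f assume "0 \<le> R" and f: "f \<in> L2_ball M"
  show "L2_norm M (\<lambda>x. pos_part (\<bar>P f x\<bar> - R)) \<le> 1"
    using L2_norm_pos_part_diff_le[of "\<lambda>x. \<bar>P f x\<bar>" R] L2_norm_P_ball[OF f] L2_ballD(1)[OF f]
      \<open>0 \<le> R\<close>
    by simp
  show "\<exists>g\<in>L2_ball M. L2_norm M (\<lambda>x. pos_part (\<bar>P f x\<bar> - S))
      \<le> L2_norm M (\<lambda>x. pos_part (\<bar>P g x\<bar> - R))" if "R \<le> S"
    using L2_norm_cutoff_le_abs[OF L2_ballD(1)[OF f] that] L2_ball_abs[OF f] by blast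
next
  fix R :: real
  show "\<exists>f\<in>L2_ball M. 0 \<le> L2_norm M (\<lambda>x. pos_part (\<bar>P f x\<bar> - R))"
    by (rule bexI[of _ "\<lambda>_. 0"]) (auto simp: L2_ball_def)
qed

lemma tau_norm_le:
  assumes "0 \<le> R"
    and "\<And>f. f \<in> L2_ball M \<Longrightarrow> (\<And>x. 0 \<le> f x) \<Longrightarrow> L2_inner M f (\<lambda>x. pos_part (P f x - R)) \<le> b"
  shows "tau_norm M P \<le> b"
  unfolding tau_norm_eq
proof (rule cutoff_family.Lim_Sup_le[OF cutoff_family_tau \<open>0 \<le> R\<close>])
  fix f assume "f \<in> L2_ball M"
  then show "L2_inner M f (\<lambda>x. pos_part (P f x - R)) \<le> b"
    using L2_inner_cutoff_le_pos_part[of f R R] assms(2)[OF L2_ball_pos_part, of f] L2_ballD(1)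
    by fastforce
qed

lemma tail_norm_le:
  assumes "0 \<le> R"
    and "\<And>f. f \<in> L2_ball M \<Longrightarrow> (\<And>x. 0 \<le> f x) \<Longrightarrow> L2_norm M (\<lambda>x. pos_part (\<bar>P f x\<bar> - R)) \<le> b"
  shows "tail_norm M P \<le> b"
  unfolding tail_norm_eq
proof (rule cutoff_family.Lim_Sup_le[OF cutoff_family_tail \<open>0 \<le> R\<close>])
  fix f assume "f \<in> L2_ball M"
  then show "L2_norm M (\<lambda>x. pos_part (\<bar>P f x\<bar> - R)) \<le> b"
    using L2_norm_cutoff_le_abs[of f R R] assms(2)[OF L2_ball_abs, of f] L2_ballD(1)
    by fastforce
qed

lemma tau_norm_ge:
  assumes "\<And>R e. 0 \<le> R \<Longrightarrow> 0 < e \<Longrightarrow>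
    \<exists>f\<in>L2_ball M. b - e \<le> L2_inner M f (\<lambda>x. pos_part (P f x - R))"
  shows "b \<le> tau_norm M P"
  unfolding tau_norm_eq using assms by (rule cutoff_family.Lim_Sup_ge[OF cutoff_family_tau])

lemma tail_norm_ge:
  assumes "\<And>R e. 0 \<le> R \<Longrightarrow> 0 < e \<Longrightarrow>
    \<exists>f\<in>L2_ball M. b - e \<le> L2_norm M (\<lambda>x. pos_part (\<bar>P f x\<bar> - R))"
  shows "b \<le> tail_norm M P"
  unfolding tail_norm_eq using assms by (rule cutoff_family.Lim_Sup_ge[OF cutoff_family_tail])

lemma tau_norm_nonneg: "0 \<le> tau_norm M P"
  unfolding tau_norm_eq by (rule cutoff_family.Lim_Sup_nonneg[OF cutoff_family_tau])

lemma tail_norm_nonneg: "0 \<le> tail_norm M P"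
  unfolding tail_norm_eq by (rule cutoff_family.Lim_Sup_nonneg[OF cutoff_family_tail])

end

section \<open>Concentration forces all tail norms to be at least one\<close>

context markov_L2
begin

lemma concentrating_imp_large_cutoff:
  assumes "concentrating P" "0 \<le> R" "0 < e"
  obtains f where "f \<in> L2_ball M" "1 - e \<le> L2_inner M f (\<lambda>x. pos_part (P f x - R))"
    "1 - e \<le> L2_norm M (\<lambda>x. pos_part (\<bar>P f x\<bar> - R))"
proof -
  define d where "d = e / (1 + R)"
  have "d > 0" using assms(2,3) by (simp add: d_def)
  have "d * (1 + R) = e" using assms(2) by (simp add: d_def)
  then have d: "d + R * d = e" by (simp add: algebra_simps)
  obtain f where f: "f \<in> L2 M" and nonneg: "\<forall>x. 0 \<le> f x" and norm: "L2_norm M f = 1"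
    and form: "\<E> f \<le> d" and mean: "expectation f \<le> d"
    using assms(1) \<open>d > 0\<close> unfolding concentrating_def by blast
  have "1 - e \<le> L2_inner M f (P f) - R * expectation f"
    using mult_left_mono[OF mean \<open>0 \<le> R\<close>] form d norm by (simp add: dirichlet_form_eq f)
  also have "\<dots> = L2_inner M f (\<lambda>x. P f x - R)"
    by (simp add: f L2_inner_diff_right L2_inner_const)
  also have "\<dots> \<le> L2_inner M f (\<lambda>x. pos_part (P f x - R))"
    using nonneg by (intro L2_inner_mono AE_I2) (auto intro!: mult_left_mono simp: f)
  finally have tau_low: "1 - e \<le> L2_inner M f (\<lambda>x. pos_part (P f x - R))" .
  also have "\<dots> \<le> L2_inner M f (\<lambda>x. pos_part (\<bar>P f x\<bar> - R))"
    using nonneg by (intro L2_inner_mono AE_I2) (auto intro!: mult_left_mono pos_part_mono simp: f)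
  also have "\<dots> \<le> L2_norm M (\<lambda>x. pos_part (\<bar>P f x\<bar> - R))"
    using L2_Cauchy_Schwarz[of f M "\<lambda>x. pos_part (\<bar>P f x\<bar> - R)"] norm by (simp add: f)
  finally have tail_low: "1 - e \<le> L2_norm M (\<lambda>x. pos_part (\<bar>P f x\<bar> - R))" .
  show ?thesis by (rule that[OF _ tau_low tail_low]) (simp add: L2_ball_def f norm)
qed

lemma concentrating_imp_tau_norm_ge_1:
  assumes "concentrating P"
  shows "1 \<le> tau_norm M P"
  by (rule tau_norm_ge) (use concentrating_imp_large_cutoff[OF assms] in metis)

lemma concentrating_imp_tail_norm_ge_1:
  assumes "concentrating P"
  shows "1 \<le> tail_norm M P"
  by (rule tail_norm_ge) (use concentrating_imp_large_cutoff[OF assms] in metis)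

lemma dirichlet_form_funpow_le:
  assumes f: "f \<in> L2 M" "L2_norm M f = 1"
  shows "dirichlet_form (P ^^ k) f \<le> real k * sqrt (2 * \<E> f)"
proof -
  have "dirichlet_form (P ^^ k) f = - L2_inner M f (\<lambda>x. (P ^^ k) f x - f x)"
    using f by (simp add: markov_L2.dirichlet_form_eq[OF funpow_markov_L2] L2_inner_diff_right
        flip: L2_norm_power2)
  also have "\<dots> \<le> L2_norm M (\<lambda>x. (P ^^ k) f x - f x)"
    using L2_Cauchy_Schwarz[of f M "\<lambda>x. (P ^^ k) f x - f x"] f by simp
  also have "\<dots> \<le> real k * L2_norm M (\<lambda>x. P f x - f x)" by (rule L2_norm_funpow_diff_le[OF f(1)])
  also have "\<dots> \<le> real k * sqrt (2 * \<E> f)"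
    by (intro mult_left_mono real_le_rsqrt L2_norm_P_diff_power2_le f) simp
  finally show ?thesis .
qed

lemma concentrating_funpow:
  assumes "concentrating P"
  shows "concentrating (P ^^ k)"
  unfolding concentrating_def
proof (intro allI impI)
  fix \<epsilon> :: real assume "\<epsilon> > 0"
  define s where "s = \<epsilon> / real (Suc k)"
  have s: "s > 0" "real k * s \<le> \<epsilon>" using \<open>\<epsilon> > 0\<close> by (auto simp: s_def field_simps)
  have "min \<epsilon> (s\<^sup>2 / 2) > 0" using s(1) \<open>\<epsilon> > 0\<close> by simp
  then obtain f where f: "f \<in> L2 M" "\<forall>x. 0 \<le> f x" "L2_norm M f = 1"
    and form: "\<E> f \<le> min \<epsilon> (s\<^sup>2 / 2)" and mean: "expectation f \<le> min \<epsilon> (s\<^sup>2 / 2)"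
    using assms unfolding concentrating_def by blast
  have "sqrt (2 * \<E> f) \<le> s" using form s(1) by (intro real_le_lsqrt) auto
  then have "real k * sqrt (2 * \<E> f) \<le> real k * s" by (intro mult_left_mono) auto
  then have "dirichlet_form (P ^^ k) f \<le> \<epsilon>"
    using dirichlet_form_funpow_le[OF f(1,3), of k] s(2) by linarith
  then show "\<exists>f\<in>L2 M. (\<forall>x. 0 \<le> f x) \<and> L2_norm M f = 1 \<and>
      dirichlet_form (P ^^ k) f \<le> \<epsilon> \<and> expectation f \<le> \<epsilon>"
    using f mean by auto
qed

end

section \<open>A spectral gap bounds the tail norms\<close>

context markov_L2
begin

lemma spectral_gapE:
  assumes "spectral_gap P"
  obtains r where "0 < r" "r \<le> 1" "poincare_inequality P (1 / r)"
proof -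
  obtain C where C: "\<And>f. f \<in> L2 M \<Longrightarrow> variance f \<le> C * \<E> f"
    using assms by (auto simp: spectral_gap_def poincare_inequality_def)
  have "variance f \<le> max C 1 * \<E> f" if "f \<in> L2 M" for f
    using C[OF that] mult_right_mono[OF max.cobounded1 dirichlet_form_nonneg[OF that], of C 1]
    by linarith
  then show ?thesis using that[of "1 / max C 1"] by (simp add: poincare_inequality_def)
qed

lemma poincare_inequality_imp_L2_inner_le:
  assumes "poincare_inequality P (1 / r)" "0 < r" and f: "f \<in> L2 M"
  shows "L2_inner M f (P f) \<le> (1 - r) * (L2_norm M f)\<^sup>2 + r * (expectation f)\<^sup>2"
proof -
  have "variance f \<le> \<E> f / r" using assms(1) f by (simp add: poincare_inequality_def)
  then have "r * variance f \<le> \<E> f" using \<open>0 < r\<close> by (simp add: pos_le_divide_eq mult.commute)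
  then show ?thesis
    unfolding L2_variance_eq[OF f] dirichlet_form_eq[OF f] by (simp add: algebra_simps)
qed

lemma expectation_excess_L2_ball:
  assumes "f \<in> L2_ball M" "0 < R"
  shows "expectation (\<lambda>x. pos_part (f x - R)) \<le> 1 / R"
proof -
  have "(L2_norm M f)\<^sup>2 / R \<le> 1 / R"
    using assms L2_ballD(2)[OF assms(1)] by (intro divide_right_mono power_le_one) auto
  then show ?thesis
    using integral_pos_part_diff_le[OF L2_ballD(1)[OF assms(1)] assms(2)] by linarith
qed

lemma L2_ball_excess:
  assumes "f \<in> L2_ball M" "0 \<le> R"
  shows "(\<lambda>x. pos_part (f x - R)) \<in> L2_ball M"
  using assms L2_norm_pos_part_diff_le[of f R] by (simp add: L2_ball_def)

lemma L2_ball_P: "f \<in> L2_ball M \<Longrightarrow> P f \<in> L2_ball M"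
  using L2_norm_P_ball by (simp add: L2_ball_def)

lemma P_le_P_excess:
  assumes f: "f \<in> L2 M"
  shows "AE x in M. P f x \<le> P (\<lambda>x. pos_part (f x - S)) x + S"
proof -
  let ?g = "\<lambda>x. pos_part (f x - S)"
  have "f x \<le> ?g x + S" for x by (simp add: pos_part_def)
  then have "AE x in M. P f x \<le> P (\<lambda>x. ?g x + S) x"
    using f by (intro P_mono AE_I2) simp_all
  then show ?thesis using P_add_const[of ?g S] f by auto
qed

lemma L2_inner_cutoff_le_excess:
  assumes f: "f \<in> L2_ball M" "\<And>x. 0 \<le> f x" and S: "0 < S" "S \<le> R"
  shows "L2_inner M f (\<lambda>x. pos_part (P f x - R))
    \<le> L2_inner M (\<lambda>x. pos_part (f x - S)) (P (\<lambda>x. pos_part (f x - S))) + S / R"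
proof -
  let ?g = "\<lambda>x. pos_part (f x - S)" and ?p = "\<lambda>x. pos_part (P f x - R)"
  have in_L2: "f \<in> L2 M" "?g \<in> L2 M" "P f \<in> L2 M" "?p \<in> L2 M" using L2_ballD(1)[OF f(1)] by simp_all
  have "AE x in M. 0 \<le> P ?g x" by (intro P_nonneg in_L2) simp
  with P_le_P_excess[OF in_L2(1), of S] have "AE x in M. f x * ?p x \<le> ?g x * P ?g x + S * ?p x"
  proof eventually_elim
    case (elim x)
    have "f x * ?p x \<le> (?g x + S) * ?p x" by (intro mult_right_mono) (auto simp: pos_part_def)
    also have "\<dots> = ?g x * ?p x + S * ?p x" by (simp add: distrib_right)
    also have "?g x * ?p x \<le> ?g x * P ?g x"
      using elim S by (intro mult_left_mono) (auto simp: pos_part_def)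
    finally show ?case by simp
  qed
  then have "L2_inner M f ?p \<le> expectation (\<lambda>x. ?g x * P ?g x + S * ?p x)"
    unfolding L2_inner_def using in_L2
    by (intro integral_mono_AE Bochner_Integration.integrable_add L2_mult_integrable
        integrable_mult_right L2_integrable) simp_all
  also have "\<dots> = L2_inner M ?g (P ?g) + S * expectation ?p"
    using in_L2 by (simp add: L2_inner_def L2_mult_integrable L2_integrable)
  also have "S * expectation ?p \<le> S * (1 / R)"
    using S by (intro mult_left_mono expectation_excess_L2_ball L2_ball_P f) auto
  finally show ?thesis by simp
qed

theorem spectral_gap_imp_tau_norm_less_1:
  assumes "spectral_gap P"
  shows "tau_norm M P < 1"
proof -
  obtain r where r: "0 < r" "r \<le> 1" and gap: "poincare_inequality P (1 / r)"
    by (rule spectral_gapE[OF assms])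
  have "tau_norm M P \<le> 1 - r / 2"
  proof (rule tau_norm_le)
    show "0 \<le> 8 / r" using r by simp
    fix f assume f: "f \<in> L2_ball M" and nonneg: "\<And>x. 0 \<le> f x"
    let ?g = "\<lambda>x. pos_part (f x - 2)"
    have g: "?g \<in> L2_ball M" by (rule L2_ball_excess[OF f]) simp
    have "(expectation ?g)\<^sup>2 \<le> (1 / 2)\<^sup>2"
      using expectation_excess_L2_ball[OF f, of 2] by (intro power_mono) auto
    then have "r * (expectation ?g)\<^sup>2 \<le> r * (1 / 2)\<^sup>2" using r by (intro mult_left_mono) auto
    moreover have "(1 - r) * (L2_norm M ?g)\<^sup>2 \<le> (1 - r) * 1"
      using r L2_ballD(2)[OF g] by (intro mult_left_mono power_le_one) auto
    ultimately have "L2_inner M ?g (P ?g) \<le> 1 - r + r / 4"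
      using poincare_inequality_imp_L2_inner_le[OF gap r(1) L2_ballD(1)[OF g]]
      by (simp add: power_divide)
    moreover have "L2_inner M f (\<lambda>x. pos_part (P f x - 8 / r)) \<le> L2_inner M ?g (P ?g) + 2 / (8 / r)"
      using r by (intro L2_inner_cutoff_le_excess f nonneg) (auto simp: le_divide_eq)
    ultimately show "L2_inner M f (\<lambda>x. pos_part (P f x - 8 / r)) \<le> 1 - r / 2" by simp
  qed
  then show ?thesis using r by simp
qed

text \<open>Polarisation: \<open>4 \<mu>(g P f) = \<mu>((f + g) P (f + g)) - \<mu>((f - g) P (f - g))\<close>. The first term is
  bounded by the gap, the second by contractivity.\<close>

lemma symmetric_poincare_inequality_imp_L2_inner_le:
  assumes sym: "is_adjoint M P P" and r: "0 < r" "r \<le> 1"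
    and gap: "poincare_inequality P (1 / r)"
    and f: "f \<in> L2_ball M" "\<And>x. 0 \<le> f x" and g: "g \<in> L2_ball M" "\<And>x. 0 \<le> g x"
  shows "L2_inner M g (P f) \<le> 1 - r / 2 + r / 4 * (expectation f + expectation g)\<^sup>2"
proof -
  let ?s = "\<lambda>x. f x + g x" and ?d = "\<lambda>x. f x - g x"
  let ?F = "(L2_norm M f)\<^sup>2" and ?G = "(L2_norm M g)\<^sup>2" and ?E = "(expectation ?s)\<^sup>2"
  have in_L2: "f \<in> L2 M" "g \<in> L2 M" using L2_ballD(1) f(1) g(1) by blast+
  have norms_le: "?F \<le> 1" "?G \<le> 1"
    using L2_ballD(2)[OF f(1)] L2_ballD(2)[OF g(1)] by (simp_all add: power_le_one)
  have "0 \<le> L2_inner M f g" using f(2) g(2) by (intro L2_inner_nonneg) auto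
  then have norm_s: "?F + ?G \<le> (L2_norm M ?s)\<^sup>2" by (simp add: L2_norm_add_power2 in_L2)
  have norms: "(L2_norm M ?s)\<^sup>2 + (L2_norm M ?d)\<^sup>2 = 2 * (?F + ?G)"
    by (simp add: L2_norm_add_power2 L2_norm_diff_power2 in_L2)
  have "4 * L2_inner M g (P f) = L2_inner M ?s (P ?s) - L2_inner M ?d (P ?d)"
    using is_adjoint_inner[OF sym in_L2] in_L2
    by (simp add: L2_inner_bilinear L2_inner_P_add L2_inner_P_diff L2_inner_commute[of M "P g" f])
  also have "\<dots> \<le> (1 - r) * (L2_norm M ?s)\<^sup>2 + r * ?E + (L2_norm M ?d)\<^sup>2"
    using poincare_inequality_imp_L2_inner_le[OF gap r(1), of ?s] abs_L2_inner_P_le[of ?d] in_L2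
    by simp
  also have "\<dots> = 2 * (?F + ?G) - r * (L2_norm M ?s)\<^sup>2 + r * ?E"
    using norms by (simp add: left_diff_distrib)
  also have "\<dots> \<le> 2 * (?F + ?G) - r * (?F + ?G) + r * ?E"
    using mult_left_mono[OF norm_s, of r] r by simp
  also have "\<dots> = (2 - r) * (?F + ?G) + r * ?E" by (simp add: left_diff_distrib)
  also have "\<dots> \<le> (2 - r) * 2 + r * ?E"
    using norms_le r by (intro add_right_mono mult_left_mono) auto
  finally show ?thesis using in_L2 by (simp add: L2_integrable)
qed

lemma L2_norm_cutoff_power2_le:
  assumes f: "f \<in> L2_ball M" "\<And>x. 0 \<le> f x" and "0 \<le> R"
  shows "(L2_norm M (\<lambda>x. pos_part (\<bar>P f x\<bar> - R)))\<^sup>2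
    \<le> L2_inner M (\<lambda>x. pos_part (P f x - R)) (P (\<lambda>x. pos_part (f x - R)))"
proof -
  let ?p = "\<lambda>x. pos_part (P f x - R)" and ?g = "\<lambda>x. pos_part (f x - R)"
  have in_L2: "f \<in> L2 M" using L2_ballD(1)[OF f(1)] .
  have P_f: "AE x in M. 0 \<le> P f x" by (rule P_nonneg[OF in_L2]) (simp add: f)
  have "L2_norm M (\<lambda>x. pos_part (\<bar>P f x\<bar> - R)) = L2_norm M ?p"
    using P_f by (intro L2_norm_cong_AE) (auto simp: in_L2)
  moreover have "L2_inner M ?p ?p \<le> L2_inner M ?p (P ?g)"
  proof (rule L2_inner_mono)
    have "pos_part s * pos_part s \<le> pos_part s * t" if "s \<le> t" for s t
      using that by (simp add: pos_part_def max_def mult_left_mono)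
    then show "AE x in M. ?p x * ?p x \<le> ?p x * P ?g x"
      using P_le_P_excess[OF in_L2, of R] by (auto simp: diff_le_eq)
  qed (simp_all add: in_L2)
  ultimately show ?thesis by (simp add: L2_norm_power2)
qed

theorem spectral_gap_imp_tail_norm_less_1:
  assumes sym: "is_adjoint M P P" and "spectral_gap P"
  shows "tail_norm M P < 1"
proof -
  obtain r where r: "0 < r" "r \<le> 1" and gap: "poincare_inequality P (1 / r)"
    by (rule spectral_gapE[OF assms(2)])
  have "tail_norm M P \<le> sqrt (1 - r / 4)"
  proof (rule tail_norm_le)
    fix f assume f: "f \<in> L2_ball M" and nonneg: "\<And>x. 0 \<le> f x"
    let ?g = "\<lambda>x. pos_part (f x - 2)" and ?p = "\<lambda>x. pos_part (P f x - 2)"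
    have "(expectation ?g + expectation ?p)\<^sup>2 \<le> 1"
      using expectation_excess_L2_ball[OF f, of 2]
        expectation_excess_L2_ball[OF L2_ball_P[OF f], of 2]
      by (intro power_le_one) simp_all
    then have "r / 4 * (expectation ?g + expectation ?p)\<^sup>2 \<le> r / 4 * 1"
      using r by (intro mult_left_mono) auto
    moreover have "L2_inner M ?p (P ?g)
        \<le> 1 - r / 2 + r / 4 * (expectation ?g + expectation ?p)\<^sup>2"
      by (intro symmetric_poincare_inequality_imp_L2_inner_le sym r gap L2_ball_excess L2_ball_P f)
        auto
    ultimately have "(L2_norm M (\<lambda>x. pos_part (\<bar>P f x\<bar> - 2)))\<^sup>2 \<le> 1 - r / 4"
      using L2_norm_cutoff_power2_le[OF f nonneg, of 2] by simp
    then show "L2_norm M (\<lambda>x. pos_part (\<bar>P f x\<bar> - 2)) \<le> sqrt (1 - r / 4)"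
      by (rule real_le_rsqrt)
  qed simp
  also have "\<dots> < 1" using r by simp
  finally show ?thesis .
qed

lemma spectral_gap_iff_Poincare:
  "spectral_gap P \<longleftrightarrow> (\<exists>\<theta>::real. -1 \<le> \<theta> \<and> \<theta> < 1 \<and> (\<forall>f\<in>L2 M. expectation (\<lambda>x. (f x)\<^sup>2)
     \<le> 1 / (1 - \<theta>) * expectation (\<lambda>x. f x * (f x - P f x)) + (expectation f)\<^sup>2))"
  (is "_ \<longleftrightarrow> (\<exists>\<theta>. _ \<and> _ \<and> ?Poincare \<theta>)")
proof -
  have Poincare_iff: "?Poincare \<theta> \<longleftrightarrow> poincare_inequality P (1 / (1 - \<theta>))" for \<theta>
    unfolding poincare_inequality_def
    by (intro ball_cong refl)
      (simp only: L2_variance_eq L2_norm_power2 L2_inner_self dirichlet_form_def diff_le_eq)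
  show ?thesis
  proof
    assume "spectral_gap P"
    then obtain r where r: "0 < r" "r \<le> 1" "poincare_inequality P (1 / r)" by (rule spectral_gapE)
    then show "\<exists>\<theta>. -1 \<le> \<theta> \<and> \<theta> < 1 \<and> ?Poincare \<theta>"
      unfolding Poincare_iff by (intro exI[of _ "1 - r"]) simp
  next
    assume "\<exists>\<theta>. -1 \<le> \<theta> \<and> \<theta> < 1 \<and> ?Poincare \<theta>"
    then show "spectral_gap P" unfolding Poincare_iff spectral_gap_def by blast
  qed
qed

end

section \<open>The equivalences\<close>

context ergodic_markov_L2
begin

lemma spectral_gap_P_sym_iff: "spectral_gap P_sym \<longleftrightarrow> spectral_gap P"
  by (simp add: spectral_gap_def poincare_inequality_def dirichlet_form_P_sym cong: ball_cong)

lemma concentrating_P_sym_iff: "concentrating P_sym \<longleftrightarrow> concentrating P"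
  unfolding concentrating_def by (simp add: dirichlet_form_P_sym cong: bex_cong)

lemma tau_norm_funpow_less_1_imp_spectral_gap:
  assumes "tau_norm M (P ^^ k) < 1"
  shows "spectral_gap P"
proof (rule ccontr)
  assume "\<not> spectral_gap P"
  then have "concentrating (P ^^ k)"
    by (intro concentrating_funpow no_spectral_gap_imp_concentrating)
  then show False
    using markov_L2.concentrating_imp_tau_norm_ge_1[OF funpow_markov_L2] assms by fastforce
qed

lemma tail_norm_funpow_less_1_imp_spectral_gap:
  assumes "tail_norm M (P_sym ^^ k) < 1"
  shows "spectral_gap P"
proof (rule ccontr)
  assume "\<not> spectral_gap P"
  then have "concentrating (P_sym ^^ k)"
    by (intro P_sym.concentrating_funpow)
      (simp add: concentrating_P_sym_iff no_spectral_gap_imp_concentrating)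
  then show False
    using markov_L2.concentrating_imp_tail_norm_ge_1[OF P_sym.funpow_markov_L2] assms by fastforce
qed

lemma spectral_gap_iff_tau_norm: "spectral_gap P \<longleftrightarrow> tau_norm M P < 1"
  using spectral_gap_imp_tau_norm_less_1 tau_norm_funpow_less_1_imp_spectral_gap[of 1] by auto

lemma spectral_gap_iff_tau_norm_odd_powers:
  "spectral_gap P \<longleftrightarrow> (INF m\<in>{1::nat..}. tau_norm M (P ^^ (2 * m - 1))) < 1"
proof -
  have "bdd_below ((\<lambda>m. tau_norm M (P ^^ (2 * m - 1))) ` {1..})"
    by (rule bdd_belowI2[of _ 0]) (rule markov_L2.tau_norm_nonneg[OF funpow_markov_L2])
  then have "(INF m\<in>{1..}. tau_norm M (P ^^ (2 * m - 1))) < 1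
      \<longleftrightarrow> (\<exists>m\<in>{1..}. tau_norm M (P ^^ (2 * m - 1)) < 1)"
    by (intro cINF_less_iff) auto
  then show ?thesis
    using spectral_gap_imp_tau_norm_less_1 tau_norm_funpow_less_1_imp_spectral_gap
    by (auto intro!: bexI[of _ 1])
qed

lemma spectral_gap_iff_tail_norm_powers:
  "spectral_gap P \<longleftrightarrow> (INF m\<in>{1::nat..}. tail_norm M (P_sym ^^ m)) < 1"
proof -
  have "bdd_below ((\<lambda>m. tail_norm M (P_sym ^^ m)) ` {1..})"
    by (rule bdd_belowI2[of _ 0]) (rule markov_L2.tail_norm_nonneg[OF P_sym.funpow_markov_L2])
  then have "(INF m\<in>{1..}. tail_norm M (P_sym ^^ m)) < 1
      \<longleftrightarrow> (\<exists>m\<in>{1..}. tail_norm M (P_sym ^^ m) < 1)"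
    by (intro cINF_less_iff) auto
  then show ?thesis
    using P_sym.spectral_gap_imp_tail_norm_less_1[OF is_adjoint_P_sym]
      tail_norm_funpow_less_1_imp_spectral_gap
    by (auto simp: spectral_gap_P_sym_iff intro!: bexI[of _ 1])
qed

end

theorem theorem1p1:
  fixes M :: "'a measure"
    and P Pstar :: "('a \<Rightarrow> real) \<Rightarrow> ('a \<Rightarrow> real)"
  assumes "prob_space M"
    and "markov_operator M P"
    and "invariant_measure M P"
    and "ergodic_op M P"
    and "is_adjoint M P Pstar"
  defines "Phat \<equiv> (\<lambda>f x. (P f x + Pstar f x) / 2)"
  shows
    "((\<exists>\<theta>::real. -1 \<le> \<theta> \<and> \<theta> < 1 \<and>
        (\<forall>f\<in>L2 M. integral\<^sup>L M (\<lambda>x. (f x)\<^sup>2)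
           \<le> 1 / (1 - \<theta>) * integral\<^sup>L M (\<lambda>x. f x * (f x - P f x)) + (integral\<^sup>L M f)\<^sup>2))
      \<longleftrightarrow> tau_norm M P < 1)
     \<and> (tau_norm M P < 1 \<longleftrightarrow> (INF m\<in>{1::nat..}. tau_norm M (P ^^ (2 * m - 1))) < 1)
     \<and> (tau_norm M P < 1 \<longleftrightarrow> (INF m\<in>{1::nat..}. tail_norm M (Phat ^^ m)) < 1)"
proof -
  interpret prob_space M by fact
  interpret ergodic_markov_L2 M P Pstar by unfold_locales fact+
  have Phat_eq: "Phat = P_sym" by (simp add: Phat_def P_sym_def[abs_def])
  show ?thesis
    unfolding Phat_eq spectral_gap_iff_Poincare[symmetric] spectral_gap_iff_tau_norm[symmetric]
      spectral_gap_iff_tau_norm_odd_powers[symmetric] spectral_gap_iff_tail_norm_powers[symmetric]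
    by simp
qed

end
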